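(* Assume $\lambda_0\in(0,1)$ and $\|K_j-P_j\|\le \lambda_0$ for all $j\in[d]$. If for some $\eta_{\mathrm{RCW}}\in(0,1]$, $$\|P_{\mathrm{RCW}}-\Pi\|\le 1-\eta_{\mathrm{RCW}},$$ then $$\|P_{\mathrm{DCW}}-\Pi\|\le 1-\frac{(1-\lambda_0)^2}{8(d+1)(1+\lambda_0)}\,\eta_{\mathrm{RCW}}.$$
   Context: Let $[d]=\{1,\dots,d\}$. Let $(\mathcal X_j,\mathcal B_j)$, $j\in[d]$, be Polish measurable spaces, $\mathcal X=\prod_{j=1}^d\mathcal X_j$ with product $\sigma$-algebra, and $\Pi$ a probability measure on $\mathcal X$. Write $x=(x_1,\dots,x_d)$ and $x_{-j}=(x_i)_{i\ne j}$. Let $\Pi_j(\mathrm dx_j\mid x_{-j})$ be a (regular) conditional distribution of $x_j$ given $x_{-j}$ under $\Pi$. $L^2(\Pi)$ has inner product $\langle f,g\rangle_\Pi=\int fg\,\mathrm d\Pi$ and norm $\|\cdot\|_\Pi$; $\|\cdot\|$ denotes the operator norm on $L^2(\Pi)$; $\Pi$ also denotes the operator sending $f$ to the constant function $\int f\,\mathrm d\Pi$. A Markov kernel $K$ acts by $(Kf)(x)=\int f(y)K(x,\mathrm dy)$. Gibbs update: $(P_jf)(x_j,x_{-j})=\int f(y_j,x_{-j})\,\Pi_j(\mathrm dy_j\mid x_{-j})$. Component-wise update: for each $j$ and $x_{-j}$, $K_{j,x_{-j}}$ is a Markov kernel on $\mathcal X_j$ reversible with respect to $\Pi_j(\cdot\mid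 x_{-j})$, with $(x_j,x_{-j})\mapsto K_{j,x_{-j}}(x_j,A_j)$ measurable for each $A_j\in\mathcal B_j$, and $(K_jf)(x_j,x_{-j})=\int f(y_j,x_{-j})\,K_{j,x_{-j}}(x_j,\mathrm dy_j)$. Random-scan and deterministic-scan component-wise kernels: $P_{\mathrm{RCW}}=\frac1d\sum_{j=1}^dK_j$ and $P_{\mathrm{DCW}}=K_d\cdots K_1$. *)

theory Defs
  imports "HOL-Probability.Probability"
begin

text \<open>
  The factors may be different spaces: all of them are carved out of one type \<open>'a\<close> as
  measurable spaces \<open>M 1, ..., M d\<close>, and a point of the product is an extensional function on
  \<open>{1..d}\<close>, as in \<^const>\<open>PiM\<close>.  Since measures on \<open>'a\<close> have explicit carriers, a Polish measurable
  space is a measurable space whose sets are the Borel sets of some Polish topology on its carrier.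
\<close>

definition polish_measurable_space :: "'a measure \<Rightarrow> bool" where
  "polish_measurable_space N \<longleftrightarrow>
     (\<exists>T. completely_metrizable_space T \<and> second_countable T \<and>
          sets N = sigma_sets (topspace T) {U. openin T U})"

definition others :: "nat \<Rightarrow> nat \<Rightarrow> nat set" where
  "others d j = {1..d} - {j}"

definition regular_conditional_distribution ::
  "nat \<Rightarrow> (nat \<Rightarrow> 'a measure) \<Rightarrow> (nat \<Rightarrow> 'a) measure \<Rightarrow> nat \<Rightarrow> ((nat \<Rightarrow> 'a) \<Rightarrow> 'a measure) \<Rightarrow> bool" where
  "regular_conditional_distribution d M \<pi> j \<kappa> \<longleftrightarrow>
     \<kappa> \<in> measurable (PiM (others d j) M) (prob_algebra (M j)) \<and>
     (\<forall>A\<in>sets (M j). \<forall>B\<in>sets (PiM (others d j) M).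
        emeasure \<pi> {x \<in> space \<pi>. x j \<in> A \<and> restrict x (others d j) \<in> B} =
        (\<integral>\<^sup>+z\<in>B. emeasure (\<kappa> z) A
           \<partial>distr \<pi> (PiM (others d j) M) (\<lambda>x. restrict x (others d j))))"

definition reversible_kernel :: "'a measure \<Rightarrow> ('a \<Rightarrow> 'a measure) \<Rightarrow> bool" where
  "reversible_kernel \<mu> k \<longleftrightarrow>
     (\<forall>A\<in>sets \<mu>. \<forall>B\<in>sets \<mu>.
        (\<integral>\<^sup>+x\<in>A. emeasure (k x) B \<partial>\<mu>) = (\<integral>\<^sup>+x\<in>B. emeasure (k x) A \<partial>\<mu>))"

text \<open>In \<open>K j z x\<close> below, \<open>z\<close> stands for \<open>x\<^sub>-\<^sub>j\<close> and \<open>x\<close> for \<open>x\<^sub>j\<close>.\<close>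

definition componentwise_kernel ::
  "nat \<Rightarrow> (nat \<Rightarrow> 'a measure) \<Rightarrow> nat \<Rightarrow> ((nat \<Rightarrow> 'a) \<Rightarrow> 'a measure)
     \<Rightarrow> ((nat \<Rightarrow> 'a) \<Rightarrow> 'a \<Rightarrow> 'a measure) \<Rightarrow> bool" where
  "componentwise_kernel d M j \<kappa> k \<longleftrightarrow>
     (\<forall>z\<in>space (PiM (others d j) M).
        k z \<in> measurable (M j) (prob_algebra (M j)) \<and> reversible_kernel (\<kappa> z) (k z)) \<and>
     (\<forall>A\<in>sets (M j).
        (\<lambda>(x, z). emeasure (k z x) A) \<in> borel_measurable (M j \<Otimes>\<^sub>M PiM (others d j) M))"

text \<open>
  Operators act on representatives of elements of \<open>L\<^sup>2(\<pi>)\<close>.  For \<open>f\<close> in \<open>L\<^sup>2(\<pi>)\<close> the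
  integrals below exist for \<open>\<pi>\<close>-almost all \<open>x\<close>; elsewhere the Bochner integral is 0.
\<close>

definition gibbs_update ::
  "nat \<Rightarrow> (nat \<Rightarrow> (nat \<Rightarrow> 'a) \<Rightarrow> 'a measure) \<Rightarrow> nat \<Rightarrow> ((nat \<Rightarrow> 'a) \<Rightarrow> real) \<Rightarrow> (nat \<Rightarrow> 'a) \<Rightarrow> real" where
  "gibbs_update d \<kappa> j f x = (\<integral>y. f (x(j := y)) \<partial>\<kappa> j (restrict x (others d j)))"

definition cw_update ::
  "nat \<Rightarrow> (nat \<Rightarrow> (nat \<Rightarrow> 'a) \<Rightarrow> 'a \<Rightarrow> 'a measure) \<Rightarrow> nat \<Rightarrow> ((nat \<Rightarrow> 'a) \<Rightarrow> real)
     \<Rightarrow> (nat \<Rightarrow> 'a) \<Rightarrow> real" where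
  "cw_update d K j f x = (\<integral>y. f (x(j := y)) \<partial>K j (restrict x (others d j)) (x j))"

definition rcw ::
  "nat \<Rightarrow> (nat \<Rightarrow> (nat \<Rightarrow> 'a) \<Rightarrow> 'a \<Rightarrow> 'a measure) \<Rightarrow> ((nat \<Rightarrow> 'a) \<Rightarrow> real) \<Rightarrow> (nat \<Rightarrow> 'a) \<Rightarrow> real" where
  "rcw d K f x = (1 / real d) * (\<Sum>j\<in>{1..d}. cw_update d K j f x)"

text \<open>\<open>fold\<close> runs through the list from the left, so this is the operator product
  \<open>K\<^sub>d \<circ> ... \<circ> K\<^sub>1\<close>, with \<open>K\<^sub>1\<close> applied to \<open>f\<close> first.\<close>

definition dcw ::
  "nat \<Rightarrow> (nat \<Rightarrow> (nat \<Rightarrow> 'a) \<Rightarrow> 'a \<Rightarrow> 'a measure) \<Rightarrow> ((nat \<Rightarrow> 'a) \<Rightarrow> real) \<Rightarrow> (nat \<Rightarrow> 'a) \<Rightarrow> real" where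
  "dcw d K = fold (cw_update d K) [1..<Suc d]"

definition mean_op :: "'b measure \<Rightarrow> ('b \<Rightarrow> real) \<Rightarrow> 'b \<Rightarrow> real" where
  "mean_op \<pi> f x = (\<integral>y. f y \<partial>\<pi>)"

definition L2 :: "'b measure \<Rightarrow> ('b \<Rightarrow> real) set" where
  "L2 \<pi> = {f \<in> borel_measurable \<pi>. integrable \<pi> (\<lambda>x. f x * f x)}"

definition L2_inner :: "'b measure \<Rightarrow> ('b \<Rightarrow> real) \<Rightarrow> ('b \<Rightarrow> real) \<Rightarrow> real" where
  "L2_inner \<pi> f g = (\<integral>x. f x * g x \<partial>\<pi>)"

definition L2_norm :: "'b measure \<Rightarrow> ('b \<Rightarrow> real) \<Rightarrow> real" where
  "L2_norm \<pi> f = sqrt (L2_inner \<pi> f f)"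

text \<open>The operator norm is \<open>\<infinity>\<close> unless the operator is bounded from \<open>L\<^sup>2(\<pi>)\<close> to \<open>L\<^sup>2(\<pi>)\<close>.\<close>

definition L2_opnorm :: "'b measure \<Rightarrow> (('b \<Rightarrow> real) \<Rightarrow> 'b \<Rightarrow> real) \<Rightarrow> ereal" where
  "L2_opnorm \<pi> T =
     Inf {ereal c | c. 0 \<le> c \<and> (\<forall>f\<in>L2 \<pi>. T f \<in> L2 \<pi> \<and> L2_norm \<pi> (T f) \<le> c * L2_norm \<pi> f)}"

definition op_diff ::
  "(('b \<Rightarrow> real) \<Rightarrow> 'b \<Rightarrow> real) \<Rightarrow> (('b \<Rightarrow> real) \<Rightarrow> 'b \<Rightarrow> real) \<Rightarrow> ('b \<Rightarrow> real) \<Rightarrow> 'b \<Rightarrow> real" where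
  "op_diff S T f x = S f x - T f x"

end

theory Submission
  imports Defs
begin

text \<open>
  Each \<open>P\<^sub>j\<close> is an orthogonal projection of \<open>L\<^sup>2(\<pi>)\<close> and \<open>K\<^sub>j\<close> is self-adjoint with
  \<open>K\<^sub>j P\<^sub>j = P\<^sub>j\<close>, so with respect to the splitting into the range of \<open>P\<^sub>j\<close> and its orthogonal
  complement, \<open>K\<^sub>j\<close> is the direct sum of the identity and an operator of norm at most \<open>\<lambda>\<^sub>0\<close>.  Write
  \<open>R\<^sub>j = I - P\<^sub>j\<close>.  For every \<open>g\<close> in \<open>L\<^sup>2(\<pi>)\<close>,

    \<^item> \<open>\<parallel>g\<parallel>\<^sup>2 - \<parallel>K\<^sub>j g\<parallel>\<^sup>2 \<ge> (1 - \<lambda>\<^sub>0\<^sup>2) \<parallel>R\<^sub>j g\<parallel>\<^sup>2\<close> (\<open>norm_T_decrease\<close>),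

    \<^item> \<open>\<parallel>g - K\<^sub>j g\<parallel> \<le> (1 + \<lambda>\<^sub>0) \<parallel>R\<^sub>j g\<parallel>\<close> (\<open>norm_T_step\<close>),

    \<^item> \<open>\<langle>g, g - K\<^sub>j g\<rangle> \<le> (1 + \<lambda>\<^sub>0) \<parallel>R\<^sub>j g\<parallel>\<^sup>2\<close> (\<open>dirichlet_form_le\<close>).

  Let \<open>f\<close> be centred, \<open>F\<^sub>0 = f\<close>, \<open>F\<^sub>j = K\<^sub>j F\<^sub>j\<^sub>-\<^sub>1\<close> and \<open>a\<^sub>j = \<parallel>R\<^sub>j F\<^sub>j\<^sub>-\<^sub>1\<parallel>\<close>, and let \<open>S\<close> be the sum of
  the \<open>a\<^sub>j\<^sup>2\<close>.  The first bound, summed along the sweep, says that the sweep lowers the squared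
  norm of \<open>f\<close> by at least \<open>(1 - \<lambda>\<^sub>0\<^sup>2) S\<close>.  By the second, \<open>F\<^sub>j\<^sub>-\<^sub>1\<close> is close to \<open>f\<close>, so that
  \<open>\<parallel>R\<^sub>j f\<parallel> \<le> a\<^sub>j + (1 + \<lambda>\<^sub>0) (a\<^sub>1 + \<dots> + a\<^sub>j\<^sub>-\<^sub>1)\<close>, and Cauchy-Schwarz bounds the sum over
  \<open>j\<close> of \<open>\<parallel>R\<^sub>j f\<parallel>\<^sup>2\<close> by \<open>2 d (d + 1) S\<close>.  The gap of the random scan and the third bound give
  \<open>d \<eta> \<parallel>f\<parallel>\<^sup>2 \<le> (1 + \<lambda>\<^sub>0) \<Sum>\<^sub>j \<parallel>R\<^sub>j f\<parallel>\<^sup>2\<close>.  Together, \<open>S\<close> is at least a fixed multiple of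
  \<open>\<parallel>f\<parallel>\<^sup>2\<close>; this is \<open>sweep_contraction\<close>.

  It remains to see that the given kernels produce such operators.  Disintegrating \<open>\<pi>\<close> along
  coordinate \<open>j\<close> shows that a kernel that is reversible for the conditional distributions becomes
  a kernel on the product space that is reversible for \<open>\<pi>\<close> (\<open>reversible_lifted_kernel\<close>), and a
  reversible kernel acts on \<open>L\<^sup>2(\<pi>)\<close> as a self-adjoint operator (\<open>avg_selfadjoint\<close>).  The Gibbs
  update is the special case of a kernel that forgets its starting point.
\<close>

section \<open>The inner product of \<open>L\<^sup>2\<close>\<close>

lemma L2_measurable: "f \<in> L2 N \<Longrightarrow> f \<in> borel_measurable N"
  by (simp add: L2_def)

lemma L2_mult_integrable:
  assumes "f \<in> L2 N" "g \<in> L2 N"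
  shows "integrable N (\<lambda>x. f x * g x)"
proof (rule Bochner_Integration.integrable_bound)
  show "integrable N (\<lambda>x. f x * f x + g x * g x)"
    using assms by (simp add: L2_def)
  show "(\<lambda>x. f x * g x) \<in> borel_measurable N"
    using assms by (intro borel_measurable_times L2_measurable)
  have "\<bar>a * b\<bar> \<le> a * a + b * b" for a b :: real
    using sum_squares_bound[of a b] sum_squares_bound[of a "-b"]
    by (simp add: abs_if power2_eq_square)
  then show "AE x in N. norm (f x * g x) \<le> norm (f x * f x + g x * g x)"
    by (auto intro: order_trans[OF _ abs_ge_self])
qed

lemma L2_linear_comb:
  assumes "f \<in> L2 N" "g \<in> L2 N"
  shows "(\<lambda>x. f x + c * g x) \<in> L2 N"
proof -
  have "integrable N (\<lambda>x. f x * f x + 2 * c * (f x * g x) + c * c * (g x * g x))"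
    using assms L2_mult_integrable by (intro Bochner_Integration.integrable_add) auto
  then have "integrable N (\<lambda>x. (f x + c * g x) * (f x + c * g x))"
    by (simp add: algebra_simps)
  moreover have "(\<lambda>x. f x + c * g x) \<in> borel_measurable N"
    using assms by (intro borel_measurable_add borel_measurable_times borel_measurable_const L2_measurable)
  ultimately show ?thesis
    by (simp add: L2_def)
qed

lemma L2_add: "f \<in> L2 N \<Longrightarrow> g \<in> L2 N \<Longrightarrow> (\<lambda>x. f x + g x) \<in> L2 N"
  using L2_linear_comb[of f N g 1] by simp

lemma L2_diff: "f \<in> L2 N \<Longrightarrow> g \<in> L2 N \<Longrightarrow> (\<lambda>x. f x - g x) \<in> L2 N"
  using L2_linear_comb[of f N g "-1"] by simp

lemma (in finite_measure) L2_const: "(\<lambda>_. c) \<in> L2 M"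
  by (simp add: L2_def)

lemma (in finite_measure) L2_integrable: "f \<in> L2 M \<Longrightarrow> integrable M f"
  using L2_mult_integrable[OF _ L2_const[of 1]] by simp

lemma L2_inner_commute: "L2_inner N f g = L2_inner N g f"
  by (simp add: L2_inner_def mult.commute)

lemma L2_inner_linear_right:
  assumes "f \<in> L2 N" "g \<in> L2 N" "h \<in> L2 N"
  shows "L2_inner N h (\<lambda>x. f x + c * g x) = L2_inner N h f + c * L2_inner N h g"
proof -
  have "L2_inner N h (\<lambda>x. f x + c * g x) = (\<integral>x. h x * f x + c * (h x * g x) \<partial>N)"
    by (simp add: L2_inner_def algebra_simps)
  also have "\<dots> = L2_inner N h f + c * L2_inner N h g"
    using assms by (simp add: L2_inner_def L2_mult_integrable)
  finally show ?thesis .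
qed

lemma L2_inner_linear_left:
  assumes "f \<in> L2 N" "g \<in> L2 N" "h \<in> L2 N"
  shows "L2_inner N (\<lambda>x. f x + c * g x) h = L2_inner N f h + c * L2_inner N g h"
  by (subst (1 2 3) L2_inner_commute) (rule L2_inner_linear_right[OF assms])

lemma L2_inner_add_right:
  "f \<in> L2 N \<Longrightarrow> g \<in> L2 N \<Longrightarrow> h \<in> L2 N \<Longrightarrow>
    L2_inner N h (\<lambda>x. f x + g x) = L2_inner N h f + L2_inner N h g"
  using L2_inner_linear_right[of f N g h 1] by simp

lemma L2_inner_diff_right:
  "f \<in> L2 N \<Longrightarrow> g \<in> L2 N \<Longrightarrow> h \<in> L2 N \<Longrightarrow>
    L2_inner N h (\<lambda>x. f x - g x) = L2_inner N h f - L2_inner N h g"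
  using L2_inner_linear_right[of f N g h "-1"] by simp

lemma L2_inner_diff_left:
  "f \<in> L2 N \<Longrightarrow> g \<in> L2 N \<Longrightarrow> h \<in> L2 N \<Longrightarrow>
    L2_inner N (\<lambda>x. f x - g x) h = L2_inner N f h - L2_inner N g h"
  using L2_inner_linear_left[of f N g h "-1"] by simp

lemma L2_inner_add_left:
  "f \<in> L2 N \<Longrightarrow> g \<in> L2 N \<Longrightarrow> h \<in> L2 N \<Longrightarrow>
    L2_inner N (\<lambda>x. f x + g x) h = L2_inner N f h + L2_inner N g h"
  using L2_inner_linear_left[of f N g h 1] by simp

lemma L2_norm_nonneg: "0 \<le> L2_norm N f"
  by (simp add: L2_norm_def L2_inner_def)

lemma L2_norm_square: "(L2_norm N f)\<^sup>2 = L2_inner N f f"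
  by (simp add: L2_norm_def L2_inner_def)

lemma L2_inner_cong_AE:
  assumes "f \<in> L2 N" "f' \<in> L2 N" "g \<in> L2 N" "g' \<in> L2 N"
    and "AE x in N. f x = f' x" "AE x in N. g x = g' x"
  shows "L2_inner N f g = L2_inner N f' g'"
  unfolding L2_inner_def using assms by (intro integral_cong_AE) (auto simp: L2_def)

lemma L2_norm_cong_AE:
  assumes "f \<in> L2 N" "g \<in> L2 N" "AE x in N. f x = g x"
  shows "L2_norm N f = L2_norm N g"
  unfolding L2_norm_def using assms L2_inner_cong_AE[of f N g f g] by simp

text \<open>
  The inner product is only positive semidefinite on functions, so the discriminant argument has
  to treat separately the case that \<open>g\<close> vanishes almost everywhere.
\<close>
lemma L2_Cauchy_Schwarz:
  assumes f: "f \<in> L2 N" and g: "g \<in> L2 N"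
  shows "\<bar>L2_inner N f g\<bar> \<le> L2_norm N f * L2_norm N g"
proof -
  define a b c where "a = L2_inner N f f" "b = L2_inner N f g" "c = L2_inner N g g"
  have "0 \<le> a + 2 * b * t + c * t\<^sup>2" for t
  proof -
    have h: "(\<lambda>x. f x + t * g x) \<in> L2 N"
      using f g by (rule L2_linear_comb)
    have "0 \<le> L2_inner N (\<lambda>x. f x + t * g x) (\<lambda>x. f x + t * g x)"
      by (simp add: L2_inner_def)
    also have "\<dots> = a + 2 * b * t + c * t\<^sup>2"
      using f g h
      by (simp add: L2_inner_linear_right a_b_c_def power2_eq_square algebra_simps
          L2_inner_linear_left L2_inner_commute[of N g f])
    finally show ?thesis .
  qed note pos = this
  have nn: "a \<ge> 0" "c \<ge> 0" by (auto simp: a_b_c_def L2_inner_def)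
  have "b\<^sup>2 \<le> a * c"
  proof (cases "c = 0")
    case True
    have "b = 0"
    proof (rule ccontr)
      assume "b \<noteq> 0"
      then show False
        \<comment> \<open>at this argument the function \<open>a + 2 b t\<close>, which is affine as \<open>c = 0\<close>, takes the value \<open>-1\<close>\<close>
        using pos[of "- (a + 1) / (2 * b)"] True nn by (simp add: field_simps)
    qed
    then show ?thesis using True by simp
  next
    case False
    then have "0 \<le> c * (a + 2 * b * (- b / c) + c * (- b / c)\<^sup>2)"
      using pos[of "- b / c"] nn by simp
    also have "\<dots> = a * c - b\<^sup>2"
      using False by (simp add: field_simps power2_eq_square)
    finally show ?thesis by simp
  qed
  then have "\<bar>b\<bar> \<le> sqrt (a * c)"
    by (rule real_le_rsqrt[of "\<bar>b\<bar>", simplified])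
  then show ?thesis
    by (simp add: L2_norm_def real_sqrt_mult a_b_c_def)
qed

lemma L2_norm_triangle:
  assumes f: "f \<in> L2 N" and g: "g \<in> L2 N"
  shows "L2_norm N (\<lambda>x. f x + g x) \<le> L2_norm N f + L2_norm N g"
proof (rule power2_le_imp_le)
  have "(L2_norm N (\<lambda>x. f x + g x))\<^sup>2 = L2_inner N f f + 2 * L2_inner N f g + L2_inner N g g"
    using f g L2_add[OF f g]
    by (simp add: L2_norm_square L2_inner_add_right L2_inner_add_left L2_inner_commute[of N g f])
  also have "\<dots> \<le> (L2_norm N f + L2_norm N g)\<^sup>2"
    using abs_le_D1[OF L2_Cauchy_Schwarz[OF f g]] by (simp add: power2_sum L2_norm_square)
  finally show "(L2_norm N (\<lambda>x. f x + g x))\<^sup>2 \<le> (L2_norm N f + L2_norm N g)\<^sup>2" .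
qed (simp add: L2_norm_nonneg)

lemma L2_norm_minus: "L2_norm N (\<lambda>x. f x - g x) = L2_norm N (\<lambda>x. g x - f x)"
  unfolding L2_norm_def L2_inner_def
  by (intro arg_cong[where f=sqrt] Bochner_Integration.integral_cong) (auto simp: algebra_simps)

lemma L2_norm_triangle_diff:
  assumes "f \<in> L2 N" "g \<in> L2 N" "h \<in> L2 N"
  shows "L2_norm N (\<lambda>x. f x - h x) \<le> L2_norm N (\<lambda>x. f x - g x) + L2_norm N (\<lambda>x. g x - h x)"
  using L2_norm_triangle[OF L2_diff[of f N g] L2_diff[of g N h]] assms by simp


text \<open>
  Nonnegative functions are where \<open>L\<^sup>2\<close> inner products can be computed with the nonnegative
  integral; this splitting carries bilinear identities over to all of \<open>L\<^sup>2\<close>.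
\<close>
lemma L2_nonneg_parts:
  assumes f: "f \<in> L2 N"
  obtains p m where "p \<in> L2 N" "m \<in> L2 N" "\<And>x. 0 \<le> p x" "\<And>x. 0 \<le> m x" "f = (\<lambda>x. p x - m x)"
proof
  have pos: "(\<lambda>x. max 0 (g x)) \<in> L2 N" if "g \<in> L2 N" for g
    using that by (auto simp: L2_def max_def elim!: Bochner_Integration.integrable_bound)
  show "(\<lambda>x. max 0 (f x)) \<in> L2 N" using f by (rule pos)
  show "(\<lambda>x. max 0 (- f x)) \<in> L2 N" using f by (intro pos) (simp add: L2_def)
qed auto


section \<open>Relaxed projections on \<open>L\<^sup>2\<close>\<close>

text \<open>
  What is used of a reversible Markov kernel acting on \<open>L\<^sup>2\<close>.  An element of \<open>L\<^sup>2\<close> is only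
  known through a representative, and the Bochner integral is \<open>0\<close> where it does not exist, so
  linearity and compatibility with almost sure equality hold almost everywhere only.
\<close>
locale L2_markov_operator = prob_space \<pi> for \<pi> :: "'b measure" +
  fixes T :: "('b \<Rightarrow> real) \<Rightarrow> 'b \<Rightarrow> real"
  assumes in_L2: "f \<in> L2 \<pi> \<Longrightarrow> T f \<in> L2 \<pi>"
    and linear: "f \<in> L2 \<pi> \<Longrightarrow> g \<in> L2 \<pi> \<Longrightarrow> AE x in \<pi>. T (\<lambda>x. f x + c * g x) x = T f x + c * T g x"
    and cong: "f \<in> L2 \<pi> \<Longrightarrow> g \<in> L2 \<pi> \<Longrightarrow> AE x in \<pi>. f x = g x \<Longrightarrow> AE x in \<pi>. T f x = T g x"
    and unit: "AE x in \<pi>. T (\<lambda>_. 1) x = 1"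
    and selfadjoint: "f \<in> L2 \<pi> \<Longrightarrow> g \<in> L2 \<pi> \<Longrightarrow> L2_inner \<pi> f (T g) = L2_inner \<pi> (T f) g"
begin

lemma diff:
  "f \<in> L2 \<pi> \<Longrightarrow> g \<in> L2 \<pi> \<Longrightarrow> AE x in \<pi>. T (\<lambda>x. f x - g x) x = T f x - T g x"
  using linear[of f g "-1"] by simp

lemma shift:
  assumes f: "f \<in> L2 \<pi>" and g: "g \<in> L2 \<pi>" and fg: "AE x in \<pi>. f x = g x + c"
  shows "AE x in \<pi>. T f x = T g x + c"
proof -
  have "AE x in \<pi>. T f x = T (\<lambda>x. g x + c * 1) x"
    using fg by (intro cong f L2_linear_comb g L2_const) auto
  with linear[OF g L2_const[of 1], of c] unit show ?thesis
    by eventually_elim simp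
qed

end

text \<open>
  \<open>P\<close> is the orthogonal projection of a Gibbs update and \<open>T\<close> a component-wise update of the same
  coordinate.  As \<open>T\<close> fixes the range of \<open>P\<close>, self-adjointness makes it preserve the orthogonal
  complement as well, and there it has norm at most \<open>r\<close>.  All estimates below compare
  a quantity with the residual \<open>g - P g\<close>, the part of \<open>g\<close> that \<open>T\<close> shrinks.
\<close>
locale relaxed_projection =
  T: L2_markov_operator \<pi> T + P: L2_markov_operator \<pi> P for \<pi> :: "'b measure" and T P +
  fixes r :: real
  assumes r: "0 \<le> r" "r < 1"
    and TP: "f \<in> L2 \<pi> \<Longrightarrow> AE x in \<pi>. T (P f) x = P f x"
    and PP: "f \<in> L2 \<pi> \<Longrightarrow> AE x in \<pi>. P (P f) x = P f x"
    and near: "f \<in> L2 \<pi> \<Longrightarrow> L2_norm \<pi> (\<lambda>x. T f x - P f x) \<le> r * L2_norm \<pi> f"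
begin

context
  fixes g assumes g: "g \<in> L2 \<pi>"
begin

lemma inner_P: "L2_inner \<pi> (P g) (P g) = L2_inner \<pi> g (P g)"
proof -
  have "L2_inner \<pi> (P g) (P g) = L2_inner \<pi> g (P (P g))"
    using g P.in_L2 by (simp add: P.selfadjoint)
  also have "\<dots> = L2_inner \<pi> g (P g)"
    using g P.in_L2 PP[OF g] by (intro L2_inner_cong_AE) auto
  finally show ?thesis .
qed

lemma inner_P_T: "L2_inner \<pi> (P g) (T g) = L2_inner \<pi> g (P g)"
proof -
  have "L2_inner \<pi> (P g) (T g) = L2_inner \<pi> (T (P g)) g"
    using g P.in_L2 by (simp add: T.selfadjoint)
  also have "\<dots> = L2_inner \<pi> (P g) g"
    using g P.in_L2 T.in_L2 TP[OF g] by (intro L2_inner_cong_AE) auto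
  finally show ?thesis by (simp add: L2_inner_commute)
qed

lemma norm_residual: "(L2_norm \<pi> (\<lambda>x. g x - P g x))\<^sup>2 = (L2_norm \<pi> g)\<^sup>2 - (L2_norm \<pi> (P g))\<^sup>2"
  using g P.in_L2[OF g] inner_P
  by (simp add: L2_norm_square L2_inner_diff_right L2_inner_diff_left L2_diff
      L2_inner_commute[of \<pi> "P g" g])

lemma norm_residual_le: "L2_norm \<pi> (\<lambda>x. g x - P g x) \<le> L2_norm \<pi> g"
  by (rule power2_le_imp_le) (simp_all add: norm_residual L2_norm_nonneg)

text \<open>
  The bound \<open>\<parallel>T - P\<parallel> \<le> r\<close> improves to one in terms of the residual, since \<open>T - P\<close> annihilates \<open>P g\<close>.
\<close>
lemma norm_T_minus_P: "L2_norm \<pi> (\<lambda>x. T g x - P g x) \<le> r * L2_norm \<pi> (\<lambda>x. g x - P g x)"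
proof -
  let ?u = "\<lambda>x. g x - P g x"
  have u: "?u \<in> L2 \<pi>" using g P.in_L2 L2_diff by blast
  have "AE x in \<pi>. T ?u x - P ?u x = T g x - P g x"
    using T.diff[OF g P.in_L2[OF g]] P.diff[OF g P.in_L2[OF g]] TP[OF g] PP[OF g]
    by eventually_elim simp
  then have "L2_norm \<pi> (\<lambda>x. T g x - P g x) = L2_norm \<pi> (\<lambda>x. T ?u x - P ?u x)"
    using g u by (intro L2_norm_cong_AE L2_diff T.in_L2 P.in_L2) auto
  also have "\<dots> \<le> r * L2_norm \<pi> ?u"
    by (rule near[OF u])
  finally show ?thesis .
qed

text \<open>
  \<open>P g\<close> is orthogonal to both \<open>g - P g\<close> and \<open>T g - P g\<close>.  Subtracting the two instances of
  Pythagoras' theorem leaves only the squared norms of these two functions, and the second is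
  at most \<open>r\<^sup>2\<close> times the first.
\<close>
lemma norm_T_decrease:
  "(1 - r\<^sup>2) * (L2_norm \<pi> (\<lambda>x. g x - P g x))\<^sup>2 \<le> (L2_norm \<pi> g)\<^sup>2 - (L2_norm \<pi> (T g))\<^sup>2"
proof -
  have "(L2_norm \<pi> (\<lambda>x. T g x - P g x))\<^sup>2 = (L2_norm \<pi> (T g))\<^sup>2 - (L2_norm \<pi> (P g))\<^sup>2"
    using g P.in_L2[OF g] T.in_L2[OF g] inner_P inner_P_T
    by (simp add: L2_norm_square L2_inner_diff_right L2_inner_diff_left L2_diff
      L2_inner_commute[of \<pi> "T g" "P g"])
  moreover have "(L2_norm \<pi> (\<lambda>x. T g x - P g x))\<^sup>2 \<le> (r * L2_norm \<pi> (\<lambda>x. g x - P g x))\<^sup>2"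
    using norm_T_minus_P L2_norm_nonneg by (rule power_mono)
  ultimately show ?thesis
    unfolding norm_residual power_mult_distrib by (simp add: norm_residual algebra_simps)
qed

lemma norm_T_step: "L2_norm \<pi> (\<lambda>x. g x - T g x) \<le> (1 + r) * L2_norm \<pi> (\<lambda>x. g x - P g x)"
  using L2_norm_triangle_diff[OF g P.in_L2[OF g] T.in_L2[OF g]] norm_T_minus_P
  by (simp add: L2_norm_minus[of \<pi> "P g"] algebra_simps)

text \<open>
  \<open>g - T g\<close> is orthogonal to the range of \<open>P\<close>, so \<open>g\<close> may be replaced by its residual in the
  first argument.
\<close>
lemma dirichlet_form_le:
  "L2_inner \<pi> g (\<lambda>x. g x - T g x) \<le> (1 + r) * (L2_norm \<pi> (\<lambda>x. g x - P g x))\<^sup>2"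
proof -
  have L2: "P g \<in> L2 \<pi>" "T g \<in> L2 \<pi>" "(\<lambda>x. g x - P g x) \<in> L2 \<pi>" "(\<lambda>x. g x - T g x) \<in> L2 \<pi>"
    using g by (simp_all add: P.in_L2 T.in_L2 L2_diff)
  have "L2_inner \<pi> g (\<lambda>x. g x - T g x) = L2_inner \<pi> (\<lambda>x. g x - P g x) (\<lambda>x. g x - T g x)"
    using g L2 inner_P_T
    by (simp add: L2_inner_diff_right L2_inner_diff_left L2_inner_commute[of \<pi> "P g" g])
  also have "\<dots> \<le> L2_norm \<pi> (\<lambda>x. g x - P g x) * L2_norm \<pi> (\<lambda>x. g x - T g x)"
    by (rule abs_le_D1[OF L2_Cauchy_Schwarz[OF L2(3,4)]])
  also have "\<dots> \<le> L2_norm \<pi> (\<lambda>x. g x - P g x) * ((1 + r) * L2_norm \<pi> (\<lambda>x. g x - P g x))"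
    by (intro mult_left_mono norm_T_step L2_norm_nonneg)
  finally show ?thesis by (simp add: power2_eq_square algebra_simps)
qed

end

text \<open>
  The residual map \<open>I - P\<close> is a contraction.  This is how the residual of the initial function
  is compared with the residual met in the middle of a sweep.
\<close>
lemma residual_lipschitz:
  assumes f: "f \<in> L2 \<pi>" and g: "g \<in> L2 \<pi>"
  shows "L2_norm \<pi> (\<lambda>x. f x - P f x) \<le> L2_norm \<pi> (\<lambda>x. f x - g x) + L2_norm \<pi> (\<lambda>x. g x - P g x)"
proof -
  let ?u = "\<lambda>x. f x - g x"
  have u: "?u \<in> L2 \<pi>" using f g by (rule L2_diff)
  have L2: "P f \<in> L2 \<pi>" "P g \<in> L2 \<pi>" "P ?u \<in> L2 \<pi>"
    using f g u P.in_L2 by auto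
  have "L2_norm \<pi> (\<lambda>x. f x - P f x) = L2_norm \<pi> (\<lambda>x. (?u x - P ?u x) + (g x - P g x))"
  proof (rule L2_norm_cong_AE)
    show "AE x in \<pi>. f x - P f x = (?u x - P ?u x) + (g x - P g x)"
      using P.diff[OF f g] by eventually_elim simp
  qed (intro f g u L2 L2_add L2_diff)+
  also have "\<dots> \<le> L2_norm \<pi> (\<lambda>x. ?u x - P ?u x) + L2_norm \<pi> (\<lambda>x. g x - P g x)"
    using f g u L2 by (intro L2_norm_triangle L2_diff)
  also have "\<dots> \<le> L2_norm \<pi> ?u + L2_norm \<pi> (\<lambda>x. g x - P g x)"
    using norm_residual_le[OF u] by simp
  finally show ?thesis .
qed

end

section \<open>Contraction of a deterministic sweep\<close>
lemma fold_upt_Suc: "fold T [1..<Suc (Suc i)] f = T (Suc i) (fold T [1..<Suc i] f)"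
  by simp

lemma sweep_rate_nonneg:
  fixes r \<eta> :: real
  assumes r: "0 \<le> r" "r < 1" and \<eta>: "0 \<le> \<eta>" "\<eta> \<le> 1"
  shows "0 \<le> 1 - (1 - r)\<^sup>2 / (8 * (real d + 1) * (1 + r)) * \<eta>"
proof -
  have "(1 - r)\<^sup>2 \<le> 1" using r by (simp add: power_le_one)
  also have "1 \<le> 8 * (real d + 1) * (1 + r)"
    using r by (intro order_trans[OF _ mult_mono[of 1 "8 * (real d + 1)" 1 "1 + r"]]) auto
  finally have "(1 - r)\<^sup>2 / (8 * (real d + 1) * (1 + r)) \<le> 1" using r by simp
  then have "(1 - r)\<^sup>2 / (8 * (real d + 1) * (1 + r)) * \<eta> \<le> 1"
    using \<eta> by (rule mult_le_one)
  then show ?thesis by linarith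
qed

text \<open>
  Write \<open>F i\<close> for the function after \<open>i\<close> steps and \<open>a i\<close> for the residual norm met by step \<open>i\<close>.
  The squared norm lost in the sweep is at least \<open>(1 - r\<^sup>2) S\<close>, where \<open>S\<close> is the sum of the
  \<open>(a i)\<^sup>2\<close>, and step \<open>i\<close> moves the function by at most \<open>(1 + r) a i\<close>.  So if little is lost, then
  the sweep has hardly moved \<open>f\<close>, and every residual norm \<open>b j\<close> of \<open>f\<close> itself is small:
  \<open>b j \<le> 2 (a 1 + \<dots> + a j)\<close>.  The spectral gap prevents this, because it bounds
  the sum of the \<open>(b j)\<^sup>2\<close> from below by a multiple of \<open>\<parallel>f\<parallel>\<^sup>2\<close>.
\<close>
lemma sweep_contraction:
  assumes rp: "\<And>j. j \<in> {1..d} \<Longrightarrow> relaxed_projection \<pi> (T j) (P j) r"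
    and r: "0 \<le> r" "r < 1" and d: "d \<ge> 1" and \<eta>: "0 \<le> \<eta>" "\<eta> \<le> 1"
    and f: "f \<in> L2 \<pi>"
    and gap: "real d * \<eta> * (L2_norm \<pi> f)\<^sup>2 \<le> (\<Sum>j\<in>{1..d}. L2_inner \<pi> f (\<lambda>x. f x - T j f x))"
  shows "L2_norm \<pi> (fold T [1..<Suc d] f)
           \<le> (1 - (1 - r)\<^sup>2 / (8 * (real d + 1) * (1 + r)) * \<eta>) * L2_norm \<pi> f"
proof -
  define F where "F i = fold T [1..<Suc i] f" for i
  define a where "a i = L2_norm \<pi> (\<lambda>x. F (i - 1) x - P i (F (i - 1)) x)" for i
  define b where "b i = L2_norm \<pi> (\<lambda>x. f x - P i f x)" for i
  define S where "S = (\<Sum>i\<in>{1..d}. (a i)\<^sup>2)"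
  let ?n = "L2_norm \<pi>"
  have F0: "F 0 = f" by (simp add: F_def)
  have FS: "F (Suc i) = T (Suc i) (F i)" for i
    unfolding F_def by (rule fold_upt_Suc)
  have FL2: "F i \<in> L2 \<pi>" if "i \<le> d" for i
    using that
  proof (induction i)
    case (Suc i)
    then interpret relaxed_projection \<pi> "T (Suc i)" "P (Suc i)" r by (intro rp) auto
    show ?case using Suc T.in_L2 by (simp add: FS)
  qed (simp add: F0 f)
  have a0: "0 \<le> a i" for i by (simp add: a_def L2_norm_nonneg)
  have drop: "(1 - r\<^sup>2) * (\<Sum>i\<in>{1..k}. (a i)\<^sup>2) \<le> (?n f)\<^sup>2 - (?n (F k))\<^sup>2" if "k \<le> d" for k
    using that
  proof (induction k)
    case (Suc k)
    then interpret relaxed_projection \<pi> "T (Suc k)" "P (Suc k)" r by (intro rp) auto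
    show ?case
      using Suc norm_T_decrease[OF FL2[of k]] by (simp add: FS a_def algebra_simps)
  qed (simp add: F0)
  have moved: "?n (\<lambda>x. f x - F k x) \<le> (1 + r) * (\<Sum>i\<in>{1..k}. a i)" if "k \<le> d" for k
    using that
  proof (induction k)
    case 0
    then show ?case by (simp add: F0 L2_norm_def L2_inner_def)
  next
    case (Suc k)
    then interpret relaxed_projection \<pi> "T (Suc k)" "P (Suc k)" r by (intro rp) auto
    have "?n (\<lambda>x. f x - F (Suc k) x) \<le> ?n (\<lambda>x. f x - F k x) + ?n (\<lambda>x. F k x - F (Suc k) x)"
      using Suc.prems by (intro L2_norm_triangle_diff FL2 f) auto
    then show ?case
      using Suc norm_T_step[OF FL2[of k]] by (simp add: FS a_def algebra_simps)
  qed
  have b_le: "(b j)\<^sup>2 \<le> 4 * real j * S" if j: "j \<in> {1..d}" for j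
  proof -
    interpret relaxed_projection \<pi> "T j" "P j" r using j by (rule rp)
    have "b j \<le> ?n (\<lambda>x. f x - F (j - 1) x) + a j"
      unfolding a_def b_def using j by (intro residual_lipschitz f FL2) auto
    also have "\<dots> \<le> (1 + r) * (\<Sum>i\<in>{1..j-1}. a i) + a j"
      using moved[of "j - 1"] j by auto
    also have "\<dots> \<le> 2 * (\<Sum>i\<in>{1..j-1}. a i) + 2 * a j"
      using r a0[of j] a0 by (intro add_mono mult_right_mono sum_nonneg) auto
    also have "\<dots> = 2 * (\<Sum>i\<in>{1..j}. a i)"
      using j by (cases j) auto
    finally have "(b j)\<^sup>2 \<le> (2 * (\<Sum>i\<in>{1..j}. a i))\<^sup>2"
      by (rule power_mono) (simp add: b_def L2_norm_nonneg)
    also have "\<dots> \<le> 4 * (real j * (\<Sum>i\<in>{1..j}. (a i)\<^sup>2))"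
      using Cauchy_Schwarz_ineq_sum[of a "\<lambda>_. 1" "{1..j}"]
      by (simp add: power_mult_distrib algebra_simps)
    also have "\<dots> \<le> 4 * (real j * S)"
      unfolding S_def using j by (intro mult_left_mono sum_mono2) auto
    finally show ?thesis by simp
  qed
  have "real d * \<eta> * (?n f)\<^sup>2 \<le> (\<Sum>j\<in>{1..d}. (1 + r) * (b j)\<^sup>2)"
    using gap
  proof (rule order_trans, intro sum_mono)
    fix j assume "j \<in> {1..d}"
    then interpret relaxed_projection \<pi> "T j" "P j" r by (rule rp)
    show "L2_inner \<pi> f (\<lambda>x. f x - T j f x) \<le> (1 + r) * (b j)\<^sup>2"
      unfolding b_def by (rule dirichlet_form_le[OF f])
  qed
  also have "\<dots> \<le> (\<Sum>j\<in>{1..d}. (1 + r) * (4 * real j * S))"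
    using r b_le by (intro sum_mono mult_left_mono) auto
  also have "\<dots> = (1 + r) * (4 * S) * (\<Sum>j\<in>{1..d}. real j)"
    unfolding sum_distrib_left by (simp add: ac_simps)
  also have "(\<Sum>j\<in>{1..d}. real j) = real d * (real d + 1) / 2"
    by (induction d) (simp_all add: field_simps)
  finally have "real d * (\<eta> * (?n f)\<^sup>2) \<le> real d * (2 * (real d + 1) * (1 + r) * S)"
    by (simp add: field_simps)
  then have S: "\<eta> * (?n f)\<^sup>2 \<le> 2 * (real d + 1) * (1 + r) * S"
    using d by (simp add: mult_le_cancel_left)
  \<comment> \<open>a loss of the fraction \<open>2 c\<close> of the squared norm suffices, since \<open>1 - 2 c \<le> (1 - c)\<^sup>2\<close>\<close>
  define c where "c = (1 - r)\<^sup>2 / (8 * (real d + 1) * (1 + r)) * \<eta>"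
  have c: "0 \<le> 1 - c"
    unfolding c_def using r \<eta> by (rule sweep_rate_nonneg)
  have "2 * c * (?n f)\<^sup>2 = (1 - r)\<^sup>2 / (4 * (real d + 1) * (1 + r)) * (\<eta> * (?n f)\<^sup>2)"
  proof -
    have *: "2 * (q / (8 * A * B) * \<eta>) * N = q / (4 * A * B) * (\<eta> * N)" if "A > 0" "B > 0"
      for A B q N :: real
      using that by (simp add: field_simps)
    show ?thesis unfolding c_def by (rule *) (use r in auto)
  qed
  also have "\<dots> \<le> (1 - r)\<^sup>2 / (4 * (real d + 1) * (1 + r)) * (2 * (real d + 1) * (1 + r) * S)"
    using S r by (intro mult_left_mono) auto
  also have "\<dots> = (1 - r)\<^sup>2 / 2 * S"
    using r by (simp add: field_simps add_nonneg_eq_0_iff)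
  also have "\<dots> \<le> (1 - r\<^sup>2) * S"
  proof (rule mult_right_mono)
    have "(1 - r)\<^sup>2 / 2 \<le> (1 - r) * (1 - r)"
      by (simp add: power2_eq_square)
    also have "\<dots> \<le> (1 - r) * (1 + r)" using r by (intro mult_left_mono) auto
    finally show "(1 - r)\<^sup>2 / 2 \<le> 1 - r\<^sup>2" by (simp add: power2_eq_square algebra_simps)
    show "0 \<le> S" by (simp add: S_def sum_nonneg)
  qed
  also have "\<dots> \<le> (?n f)\<^sup>2 - (?n (F d))\<^sup>2"
    unfolding S_def by (rule drop) simp
  finally have "(?n (F d))\<^sup>2 \<le> (1 - 2 * c) * (?n f)\<^sup>2" by (simp add: algebra_simps)
  also have "\<dots> \<le> ((1 - c) * ?n f)\<^sup>2"
    unfolding power_mult_distrib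
    by (intro mult_right_mono) (simp_all add: power2_diff)
  finally have "?n (F d) \<le> (1 - c) * ?n f"
    by (rule power2_le_imp_le[OF _ mult_nonneg_nonneg[OF c L2_norm_nonneg]])
  then show ?thesis by (simp add: F_def c_def)
qed

section \<open>Reversible Markov kernels as operators on \<open>L\<^sup>2\<close>\<close>
locale reversible_markov_kernel = prob_space \<pi> for \<pi> :: "'b measure" +
  fixes Q :: "'b \<Rightarrow> 'b measure"
  assumes kernel: "Q \<in> \<pi> \<rightarrow>\<^sub>M prob_algebra \<pi>"
    and reversible: "reversible_kernel \<pi> Q"
begin

lemma kernel_sub[measurable]: "Q \<in> \<pi> \<rightarrow>\<^sub>M subprob_algebra \<pi>"
  by (rule measurable_prob_algebraD[OF kernel])

lemma prob_space_Q: "x \<in> space \<pi> \<Longrightarrow> prob_space (Q x)"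
  and sets_Q: "x \<in> space \<pi> \<Longrightarrow> sets (Q x) = sets \<pi>"
  using measurable_space[OF kernel] by (auto simp: space_prob_algebra)

lemma measurable_Q: "x \<in> space \<pi> \<Longrightarrow> f \<in> borel_measurable \<pi> \<Longrightarrow> f \<in> borel_measurable (Q x)"
  using measurable_cong_sets[OF sets_Q refl] by blast

lemma nn_integral_Q_measurable[measurable]:
  "f \<in> borel_measurable \<pi> \<Longrightarrow> (\<lambda>x. \<integral>\<^sup>+y. f y \<partial>Q x) \<in> borel_measurable \<pi>"
  by (rule measurable_compose[OF kernel_sub nn_integral_measurable_subprob_algebra])

text \<open>
  Reversibility is given for sets.  This lemma extends the symmetry from sets to functions in one
  of the two arguments; applying it twice does both.
\<close>
lemma nn_integral_symmetric_extend:
  fixes f g :: "'b \<Rightarrow> ennreal"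
  assumes f[measurable]: "f \<in> borel_measurable \<pi>" and g: "g \<in> borel_measurable \<pi>"
    and sets: "\<And>B. B \<in> sets \<pi> \<Longrightarrow>
      (\<integral>\<^sup>+x. f x * emeasure (Q x) B \<partial>\<pi>) = (\<integral>\<^sup>+x. indicator B x * (\<integral>\<^sup>+y. f y \<partial>Q x) \<partial>\<pi>)"
  shows "(\<integral>\<^sup>+x. f x * (\<integral>\<^sup>+y. g y \<partial>Q x) \<partial>\<pi>) = (\<integral>\<^sup>+x. g x * (\<integral>\<^sup>+y. f y \<partial>Q x) \<partial>\<pi>)"
  using g
proof (induction g rule: borel_measurable_induct)
  case (cong g h)
  have "(\<integral>\<^sup>+y. g y \<partial>Q x) = (\<integral>\<^sup>+y. h y \<partial>Q x)" if "x \<in> space \<pi>" for x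
    using that cong(3) sets_eq_imp_space_eq[OF sets_Q[OF that]] by (intro nn_integral_cong) auto
  with cong(3,4) show ?case
    by (simp cong: nn_integral_cong)
next
  case (set B)
  have "(\<integral>\<^sup>+y. indicator B y \<partial>Q x) = emeasure (Q x) B" if "x \<in> space \<pi>" for x
    using that set by (simp add: sets_Q)
  with sets[OF set] show ?case
    by (simp cong: nn_integral_cong)
next
  case (mult u c)
  note [measurable] = mult(2)
  have "(\<integral>\<^sup>+y. c * u y \<partial>Q x) = c * (\<integral>\<^sup>+y. u y \<partial>Q x)" if "x \<in> space \<pi>" for x
    using that mult(2) by (intro nn_integral_cmult measurable_Q)
  then have "(\<integral>\<^sup>+x. f x * (\<integral>\<^sup>+y. c * u y \<partial>Q x) \<partial>\<pi>) = (\<integral>\<^sup>+x. c * (f x * (\<integral>\<^sup>+y. u y \<partial>Q x)) \<partial>\<pi>)"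
    by (intro nn_integral_cong) (simp add: ac_simps)
  also have "\<dots> = c * (\<integral>\<^sup>+x. u x * (\<integral>\<^sup>+y. f y \<partial>Q x) \<partial>\<pi>)"
    by (subst nn_integral_cmult) (auto simp: mult.IH)
  also have "\<dots> = (\<integral>\<^sup>+x. c * (u x * (\<integral>\<^sup>+y. f y \<partial>Q x)) \<partial>\<pi>)"
    by (subst nn_integral_cmult) auto
  finally show ?case by (simp add: ac_simps)
next
  case (add u v)
  have [measurable]: "u \<in> borel_measurable \<pi>" "v \<in> borel_measurable \<pi>"
    using add by auto
  have "(\<integral>\<^sup>+y. v y + u y \<partial>Q x) = (\<integral>\<^sup>+y. v y \<partial>Q x) + (\<integral>\<^sup>+y. u y \<partial>Q x)" if "x \<in> space \<pi>" for x
    using that add by (intro nn_integral_add measurable_Q)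
  then have "(\<integral>\<^sup>+x. f x * (\<integral>\<^sup>+y. v y + u y \<partial>Q x) \<partial>\<pi>) =
      (\<integral>\<^sup>+x. f x * (\<integral>\<^sup>+y. v y \<partial>Q x) + f x * (\<integral>\<^sup>+y. u y \<partial>Q x) \<partial>\<pi>)"
    by (intro nn_integral_cong) (simp add: distrib_left)
  also have "\<dots> = (\<integral>\<^sup>+x. v x * (\<integral>\<^sup>+y. f y \<partial>Q x) + u x * (\<integral>\<^sup>+y. f y \<partial>Q x) \<partial>\<pi>)"
    by (subst (1 2) nn_integral_add) (auto simp: add.IH)
  finally show ?case by (simp add: distrib_right)
next
  case (seq U)
  note [measurable] = seq(1)
  have "(\<integral>\<^sup>+y. (SUP i. U i y) \<partial>Q x) = (SUP i. (\<integral>\<^sup>+y. U i y \<partial>Q x))" if "x \<in> space \<pi>" for x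
    using that seq by (intro nn_integral_monotone_convergence_SUP measurable_Q)
  then have "(\<integral>\<^sup>+x. f x * (\<integral>\<^sup>+y. (SUP i. U i y) \<partial>Q x) \<partial>\<pi>) =
      (\<integral>\<^sup>+x. (SUP i. f x * (\<integral>\<^sup>+y. U i y \<partial>Q x)) \<partial>\<pi>)"
    by (intro nn_integral_cong) (simp add: SUP_mult_left_ennreal)
  also have "\<dots> = (SUP i. \<integral>\<^sup>+x. f x * (\<integral>\<^sup>+y. U i y \<partial>Q x) \<partial>\<pi>)"
    using seq(3) by (intro nn_integral_monotone_convergence_SUP)
      (auto simp: incseq_def le_fun_def intro!: mult_left_mono nn_integral_mono)
  also have "\<dots> = (SUP i. \<integral>\<^sup>+x. U i x * (\<integral>\<^sup>+y. f y \<partial>Q x) \<partial>\<pi>)"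
    by (simp add: seq.IH)
  also have "\<dots> = (\<integral>\<^sup>+x. (SUP i. U i x * (\<integral>\<^sup>+y. f y \<partial>Q x)) \<partial>\<pi>)"
    using seq(3) by (intro nn_integral_monotone_convergence_SUP[symmetric])
      (auto simp: incseq_def le_fun_def intro!: mult_right_mono)
  finally show ?case by (simp add: SUP_mult_right_ennreal image_comp)
qed

lemma nn_integral_symmetric:
  fixes f g :: "'b \<Rightarrow> ennreal"
  assumes f: "f \<in> borel_measurable \<pi>" and g: "g \<in> borel_measurable \<pi>"
  shows "(\<integral>\<^sup>+x. f x * (\<integral>\<^sup>+y. g y \<partial>Q x) \<partial>\<pi>) = (\<integral>\<^sup>+x. g x * (\<integral>\<^sup>+y. f y \<partial>Q x) \<partial>\<pi>)"
proof (rule nn_integral_symmetric_extend[OF f g])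
  fix B assume B: "B \<in> sets \<pi>"
  have ind: "(\<integral>\<^sup>+y. indicator A y \<partial>Q x) = emeasure (Q x) A" if "x \<in> space \<pi>" "A \<in> sets \<pi>" for x A
    using that by (simp add: sets_Q)
  have "(\<integral>\<^sup>+x. indicator B x * (\<integral>\<^sup>+y. f y \<partial>Q x) \<partial>\<pi>) =
      (\<integral>\<^sup>+x. f x * (\<integral>\<^sup>+y. indicator B y \<partial>Q x) \<partial>\<pi>)"
  proof (rule nn_integral_symmetric_extend[OF _ f])
    fix A assume "A \<in> sets \<pi>"
    then show "(\<integral>\<^sup>+x. indicator B x * emeasure (Q x) A \<partial>\<pi>) =
        (\<integral>\<^sup>+x. indicator A x * (\<integral>\<^sup>+y. indicator B y \<partial>Q x) \<partial>\<pi>)"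
      using reversible B by (simp add: ind reversible_kernel_def mult.commute cong: nn_integral_cong)
  qed (use B in simp)
  then show "(\<integral>\<^sup>+x. f x * emeasure (Q x) B \<partial>\<pi>) = (\<integral>\<^sup>+x. indicator B x * (\<integral>\<^sup>+y. f y \<partial>Q x) \<partial>\<pi>)"
    using B by (simp add: ind cong: nn_integral_cong)
qed

lemma nn_integral_stationary:
  assumes "f \<in> borel_measurable \<pi>"
  shows "(\<integral>\<^sup>+x. \<integral>\<^sup>+y. f y \<partial>Q x \<partial>\<pi>) = (\<integral>\<^sup>+x. f x \<partial>\<pi>)"
  using nn_integral_symmetric[OF _ assms, of "\<lambda>_. 1"]
  by (simp add: prob_space.emeasure_space_1 prob_space_Q cong: nn_integral_cong)

definition avg :: "('b \<Rightarrow> real) \<Rightarrow> 'b \<Rightarrow> real" where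
  "avg f x = (\<integral>y. f y \<partial>Q x)"

lemma avg_measurable: "f \<in> borel_measurable \<pi> \<Longrightarrow> avg f \<in> borel_measurable \<pi>"
  unfolding avg_def[abs_def]
  by (rule measurable_compose[OF kernel_sub integral_measurable_subprob_algebra])

text \<open>
  Stationarity gives \<open>f\<^sup>2\<close> the same total integral under \<open>Q\<close> and then \<open>\<pi>\<close> as under \<open>\<pi>\<close>, so it can
  be infinite under \<open>Q x\<close> only for a null set of \<open>x\<close>.
\<close>
lemma AE_L2:
  assumes f: "f \<in> L2 \<pi>"
  shows "AE x in \<pi>. f \<in> L2 (Q x)"
proof -
  have fm[measurable]: "f \<in> borel_measurable \<pi>" by (rule L2_measurable[OF f])
  have "(\<integral>\<^sup>+x. \<integral>\<^sup>+y. ennreal (f y * f y) \<partial>Q x \<partial>\<pi>) \<noteq> \<infinity>"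
    using f by (subst nn_integral_stationary) (auto simp: L2_def real_integrable_def)
  then have "AE x in \<pi>. (\<integral>\<^sup>+y. ennreal (f y * f y) \<partial>Q x) \<noteq> \<infinity>"
    by (intro nn_integral_PInf_AE) auto
  with AE_space show ?thesis
  proof eventually_elim
    case (elim x)
    then have [measurable]: "f \<in> borel_measurable (Q x)" by (intro measurable_Q fm)
    show ?case
      using elim(2) by (auto simp: L2_def less_top intro!: integrableI_nonneg)
  qed
qed

lemma AE_integrable: "f \<in> L2 \<pi> \<Longrightarrow> AE x in \<pi>. integrable (Q x) f"
  using AE_L2[of f] AE_space
  by (auto elim!: eventually_elim2
      intro: finite_measure.L2_integrable prob_space.finite_measure[OF prob_space_Q])

text \<open>Jensen's inequality \<open>(avg f x)\<^sup>2 \<le> avg f\<^sup>2 x\<close>, integrated with the help of stationarity.\<close>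
lemma avg_L2:
  assumes f: "f \<in> L2 \<pi>"
  shows "avg f \<in> L2 \<pi>"
proof -
  have fm[measurable]: "f \<in> borel_measurable \<pi>" by (rule L2_measurable[OF f])
  have [measurable]: "avg f \<in> borel_measurable \<pi>" by (rule avg_measurable[OF fm])
  have "AE x in \<pi>. ennreal (avg f x * avg f x) \<le> (\<integral>\<^sup>+y. ennreal (f y * f y) \<partial>Q x)"
    using AE_L2[OF f] AE_space
  proof eventually_elim
    case (elim x)
    interpret Q: prob_space "Q x" using elim(2) by (rule prob_space_Q)
    have "\<bar>avg f x\<bar>\<^sup>2 \<le> (L2_norm (Q x) f * L2_norm (Q x) (\<lambda>_. 1))\<^sup>2"
      using L2_Cauchy_Schwarz[OF elim(1) Q.L2_const[of 1]]
      by (intro power_mono) (simp_all add: L2_inner_def avg_def)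
    then have "avg f x * avg f x \<le> (\<integral>y. f y * f y \<partial>Q x)"
      unfolding power_mult_distrib L2_norm_square
      by (simp add: L2_inner_def Q.prob_space power2_eq_square)
    also have "ennreal \<dots> = (\<integral>\<^sup>+y. ennreal (f y * f y) \<partial>Q x)"
      using elim(1) by (subst nn_integral_eq_integral) (auto simp: L2_def)
    finally show ?case by (simp add: ennreal_leI)
  qed
  then have "(\<integral>\<^sup>+x. ennreal (avg f x * avg f x) \<partial>\<pi>) \<le> (\<integral>\<^sup>+x. \<integral>\<^sup>+y. ennreal (f y * f y) \<partial>Q x \<partial>\<pi>)"
    by (rule nn_integral_mono_AE)
  also have "\<dots> < \<infinity>"
    using f by (subst nn_integral_stationary) (auto simp: L2_def real_integrable_def less_top)
  finally show ?thesis
    by (auto simp: L2_def intro!: integrableI_nonneg)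
qed

lemma avg_linear:
  assumes f: "f \<in> L2 \<pi>" and g: "g \<in> L2 \<pi>"
  shows "AE x in \<pi>. avg (\<lambda>x. f x + c * g x) x = avg f x + c * avg g x"
  using AE_integrable[OF f] AE_integrable[OF g] by eventually_elim (simp add: avg_def)

text \<open>
  By stationarity, a \<open>\<pi>\<close>-null set is also a null set for \<open>Q x\<close>, for almost all \<open>x\<close>.
\<close>
lemma avg_cong:
  assumes f: "f \<in> L2 \<pi>" and g: "g \<in> L2 \<pi>" and fg: "AE x in \<pi>. f x = g x"
  shows "AE x in \<pi>. avg f x = avg g x"
proof -
  have [measurable]: "f \<in> borel_measurable \<pi>" "g \<in> borel_measurable \<pi>"
    using f g by (auto intro: L2_measurable)
  let ?h = "\<lambda>x. ennreal \<bar>f x - g x\<bar>"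
  have "(\<integral>\<^sup>+x. \<integral>\<^sup>+y. ?h y \<partial>Q x \<partial>\<pi>) = (\<integral>\<^sup>+x. ?h x \<partial>\<pi>)"
    by (rule nn_integral_stationary) simp
  also have "\<dots> = 0"
    using fg by (subst nn_integral_0_iff_AE) auto
  finally have "AE x in \<pi>. (\<integral>\<^sup>+y. ?h y \<partial>Q x) = 0"
    by (subst (asm) nn_integral_0_iff_AE) auto
  with AE_space show ?thesis
  proof eventually_elim
    case (elim x)
    have [measurable]: "f \<in> borel_measurable (Q x)" "g \<in> borel_measurable (Q x)"
      using elim(1) by (simp_all add: measurable_Q)
    have "AE y in Q x. f y = g y"
      using elim(2) by (subst (asm) nn_integral_0_iff_AE) auto
    then show ?case unfolding avg_def by (intro integral_cong_AE) auto
  qed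
qed

lemma avg_selfadjoint_nonneg:
  assumes f: "f \<in> L2 \<pi>" "\<And>x. 0 \<le> f x" and g: "g \<in> L2 \<pi>" "\<And>x. 0 \<le> g x"
  shows "L2_inner \<pi> f (avg g) = L2_inner \<pi> g (avg f)"
proof -
  have "L2_inner \<pi> u (avg v) = enn2real (\<integral>\<^sup>+x. ennreal (u x) * (\<integral>\<^sup>+y. ennreal (v y) \<partial>Q x) \<partial>\<pi>)"
    if u: "u \<in> L2 \<pi>" "\<And>x. 0 \<le> u x" and v: "v \<in> L2 \<pi>" "\<And>x. 0 \<le> v x" for u v
  proof -
    have [measurable]: "u \<in> borel_measurable \<pi>" "avg v \<in> borel_measurable \<pi>"
      using u v avg_L2 by (auto intro: L2_measurable)
    have "L2_inner \<pi> u (avg v) = enn2real (\<integral>\<^sup>+x. ennreal (u x * avg v x) \<partial>\<pi>)"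
      unfolding L2_inner_def
    proof (rule integral_eq_nn_integral)
      show "AE x in \<pi>. 0 \<le> u x * avg v x" using u v by (simp add: avg_def)
    qed simp
    also have "(\<integral>\<^sup>+x. ennreal (u x * avg v x) \<partial>\<pi>) =
        (\<integral>\<^sup>+x. ennreal (u x) * (\<integral>\<^sup>+y. ennreal (v y) \<partial>Q x) \<partial>\<pi>)"
      using AE_integrable[OF v(1)]
    proof (intro nn_integral_cong_AE, eventually_elim)
      case (elim x)
      have "(\<integral>\<^sup>+y. ennreal (v y) \<partial>Q x) = ennreal (avg v x)"
        unfolding avg_def using elim v(2) by (intro nn_integral_eq_integral) auto
      then show ?case using u(2) by (simp add: ennreal_mult')
    qed
    finally show ?thesis .
  qed
  then show ?thesis
    using f g nn_integral_symmetric[of "\<lambda>x. ennreal (f x)" "\<lambda>x. ennreal (g x)"]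
    by (simp add: L2_measurable)
qed

lemma avg_diff:
  "f \<in> L2 \<pi> \<Longrightarrow> g \<in> L2 \<pi> \<Longrightarrow> AE x in \<pi>. avg (\<lambda>x. f x - g x) x = avg f x - avg g x"
  using avg_linear[of f g "-1"] by simp

lemma inner_avg_diff:
  assumes "p \<in> L2 \<pi>" "m \<in> L2 \<pi>" "h \<in> L2 \<pi>"
  shows "L2_inner \<pi> h (avg (\<lambda>x. p x - m x)) = L2_inner \<pi> h (avg p) - L2_inner \<pi> h (avg m)"
proof -
  have "L2_inner \<pi> h (avg (\<lambda>x. p x - m x)) = L2_inner \<pi> h (\<lambda>x. avg p x - avg m x)"
    using avg_diff[OF assms(1,2)] by (intro L2_inner_cong_AE assms avg_L2 L2_diff) auto
  then show ?thesis
    using assms by (simp add: L2_inner_diff_right avg_L2)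
qed

lemma avg_selfadjoint:
  assumes f: "f \<in> L2 \<pi>" and g: "g \<in> L2 \<pi>"
  shows "L2_inner \<pi> f (avg g) = L2_inner \<pi> (avg f) g"
proof -
  obtain p m where f': "p \<in> L2 \<pi>" "m \<in> L2 \<pi>" "\<And>x. 0 \<le> p x" "\<And>x. 0 \<le> m x" "f = (\<lambda>x. p x - m x)"
    using L2_nonneg_parts[OF f] by blast
  obtain p' m' where g': "p' \<in> L2 \<pi>" "m' \<in> L2 \<pi>" "\<And>x. 0 \<le> p' x" "\<And>x. 0 \<le> m' x"
      "g = (\<lambda>x. p' x - m' x)"
    using L2_nonneg_parts[OF g] by blast
  have nonneg: "L2_inner \<pi> u (avg v) = L2_inner \<pi> v (avg u)" if "u \<in> {p, m}" "v \<in> {p', m'}" for u v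
    using that f' g' by (auto intro: avg_selfadjoint_nonneg)
  have "L2_inner \<pi> f (avg g) = L2_inner \<pi> f (avg p') - L2_inner \<pi> f (avg m')"
    unfolding g'(5) by (rule inner_avg_diff[OF g'(1,2) f])
  also have "\<dots> = L2_inner \<pi> g (avg p) - L2_inner \<pi> g (avg m)"
    unfolding f'(5) g'(5) using f'(1,2) g'(1,2) by (simp add: L2_inner_diff_left avg_L2
        nonneg[of p p'] nonneg[of p m'] nonneg[of m p'] nonneg[of m m'])
  also have "\<dots> = L2_inner \<pi> g (avg f)"
    unfolding f'(5) by (rule inner_avg_diff[OF f'(1,2) g, symmetric])
  finally show ?thesis by (simp add: L2_inner_commute)
qed

lemma L2_markov_operator_avg: "L2_markov_operator \<pi> avg"
proof
  show "AE x in \<pi>. avg (\<lambda>_. 1) x = 1"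
    using AE_space by eventually_elim (simp add: avg_def prob_space.prob_space prob_space_Q)
qed (fact avg_L2 avg_linear avg_cong avg_selfadjoint)+

end

text \<open>
  The component-wise updates agree with integration against a kernel on the product space only
  where the change of variables is valid, that is for measurable functions and on \<open>space \<pi>\<close>.
\<close>
lemma L2_markov_operator_eqI:
  assumes A: "L2_markov_operator \<pi> A"
    and eq: "\<And>f x. f \<in> L2 \<pi> \<Longrightarrow> x \<in> space \<pi> \<Longrightarrow> T f x = A f x"
  shows "L2_markov_operator \<pi> T"
proof -
  interpret A: L2_markov_operator \<pi> A by fact
  have AE: "AE x in \<pi>. T f x = A f x" if "f \<in> L2 \<pi>" for f
    using AE_space by eventually_elim (simp add: eq that)
  have T_L2: "T f \<in> L2 \<pi>" if f: "f \<in> L2 \<pi>" for f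
  proof -
    have "T f \<in> borel_measurable \<pi>"
      using L2_measurable[OF A.in_L2[OF f]] eq[OF f] by (simp cong: measurable_cong)
    moreover have "integrable \<pi> (\<lambda>x. T f x * T f x)"
      using A.in_L2[OF f] eq[OF f] by (simp add: L2_def cong: Bochner_Integration.integrable_cong)
    ultimately show ?thesis by (simp add: L2_def)
  qed
  show ?thesis
  proof
    fix f g and c :: real assume f: "f \<in> L2 \<pi>" and g: "g \<in> L2 \<pi>"
    show "AE x in \<pi>. T (\<lambda>x. f x + c * g x) x = T f x + c * T g x"
      using A.linear[OF f g, of c] AE[OF f] AE[OF g] AE[OF L2_linear_comb[OF f g, of c]]
      by eventually_elim simp
    show "AE x in \<pi>. T f x = T g x" if "AE x in \<pi>. f x = g x"
      using A.cong[OF f g that] AE[OF f] AE[OF g] by eventually_elim simp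
    show "L2_inner \<pi> f (T g) = L2_inner \<pi> (T f) g"
      using A.selfadjoint[OF f g] L2_inner_cong_AE[OF f f T_L2[OF g] A.in_L2[OF g] _ AE[OF g]]
        L2_inner_cong_AE[OF T_L2[OF f] A.in_L2[OF f] g g AE[OF f]] by simp
  qed (use T_L2 A.unit AE[OF A.L2_const[of 1]] in auto)
qed

section \<open>Component-wise kernels on the product space\<close>

text \<open>
  The Gibbs update is the component-wise update whose kernel draws \<open>x\<^sub>j\<close> afresh.  What is
  proved for component-wise updates therefore applies to both.
\<close>
lemma gibbs_update_eq_cw_update: "gibbs_update d \<kappa> j = cw_update d (\<lambda>j z _. \<kappa> j z) j"
  by (simp add: fun_eq_iff gibbs_update_def cw_update_def)

lemma componentwise_kernel_gibbs:
  assumes "regular_conditional_distribution d M \<pi> j \<kappa>"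
  shows "componentwise_kernel d M j \<kappa> (\<lambda>z _. \<kappa> z)"
proof -
  let ?O = "PiM (others d j) M"
  have \<kappa>: "\<kappa> \<in> ?O \<rightarrow>\<^sub>M prob_algebra (M j)"
    using assms by (simp add: regular_conditional_distribution_def)
  note [measurable] = measurable_prob_algebraD[OF \<kappa>]
  have "(\<lambda>_. \<kappa> z) \<in> M j \<rightarrow>\<^sub>M prob_algebra (M j)" if "z \<in> space ?O" for z
    using measurable_space[OF \<kappa> that] by simp
  moreover have "reversible_kernel (\<kappa> z) (\<lambda>_. \<kappa> z)" for z
    by (simp add: reversible_kernel_def nn_integral_cmult_indicator)
      (simp add: mult.commute)
  moreover have "(\<lambda>(x, z). emeasure (\<kappa> z) A) \<in> borel_measurable (M j \<Otimes>\<^sub>M ?O)"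
    if "A \<in> sets (M j)" for A
    using that by simp
  ultimately show ?thesis
    by (simp add: componentwise_kernel_def)
qed

locale conditional_component = prob_space \<pi>
  for \<pi> :: "(nat \<Rightarrow> 'a) measure" +
  fixes d :: nat and M :: "nat \<Rightarrow> 'a measure" and j :: nat and \<kappa> :: "(nat \<Rightarrow> 'a) \<Rightarrow> 'a measure"
  assumes sets_eq[measurable_cong]: "sets \<pi> = sets (PiM {1..d} M)"
    and j: "j \<in> {1..d}"
    and rcd: "regular_conditional_distribution d M \<pi> j \<kappa>"
begin

abbreviation rest :: "(nat \<Rightarrow> 'a) \<Rightarrow> nat \<Rightarrow> 'a" where
  "rest x \<equiv> restrict x (others d j)"

lemma space_eq: "space \<pi> = (\<Pi>\<^sub>E i\<in>{1..d}. space (M i))"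
  using sets_eq_imp_space_eq[OF sets_eq] by (simp add: space_PiM)

lemma rest_measurable[measurable]: "rest \<in> \<pi> \<rightarrow>\<^sub>M PiM (others d j) M"
  unfolding measurable_cong_sets[OF sets_eq refl]
  by (rule measurable_restrict_subset) (auto simp: others_def)

lemma component_measurable[measurable]: "(\<lambda>x. x j) \<in> \<pi> \<rightarrow>\<^sub>M M j"
  unfolding measurable_cong_sets[OF sets_eq refl]
  by (rule measurable_component_singleton[OF j])

lemma update_measurable[measurable]: "(\<lambda>(x, y). x(j := y)) \<in> \<pi> \<Otimes>\<^sub>M M j \<rightarrow>\<^sub>M \<pi>"
proof -
  have "(\<lambda>(x, y). x(j := y)) \<in> PiM {1..d} M \<Otimes>\<^sub>M M j \<rightarrow>\<^sub>M PiM (insert j {1..d}) M"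
    by (rule measurable_add_dim)
  then have "(\<lambda>(x, y). x(j := y)) \<in> PiM {1..d} M \<Otimes>\<^sub>M M j \<rightarrow>\<^sub>M PiM {1..d} M"
    by (simp only: insert_absorb[OF j])
  then show ?thesis
    by (simp cong: measurable_cong_sets add: sets_eq)
qed

lemma update_measurable_right: "x \<in> space \<pi> \<Longrightarrow> (\<lambda>y. x(j := y)) \<in> M j \<rightarrow>\<^sub>M \<pi>"
  using measurable_Pair2[OF update_measurable, of x] by simp

lemma update_in_space: "x \<in> space \<pi> \<Longrightarrow> y \<in> space (M j) \<Longrightarrow> x(j := y) \<in> space \<pi>"
  using measurable_space[OF update_measurable_right] by blast

lemma rest_update: "rest (x(j := y)) = rest x"
  by (auto simp: others_def restrict_def)

lemma rest_in_space: "x \<in> space \<pi> \<Longrightarrow> rest x \<in> space (PiM (others d j) M)"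
  using measurable_space[OF rest_measurable] .

lemma \<kappa>_measurable: "\<kappa> \<in> PiM (others d j) M \<rightarrow>\<^sub>M prob_algebra (M j)"
  using rcd by (simp add: regular_conditional_distribution_def)

lemma sets_\<kappa>: "x \<in> space \<pi> \<Longrightarrow> sets (\<kappa> (rest x)) = sets (M j)"
  using measurable_space[OF \<kappa>_measurable rest_in_space] by (simp add: space_prob_algebra)

lemma PiE_insert_rest:
  assumes "x \<in> space \<pi>"
  shows "x \<in> PiE {1..d} A \<longleftrightarrow> x j \<in> A j \<and> rest x \<in> PiE (others d j) A"
  using assms j by (auto simp: space_eq others_def PiE_iff)

definition resample :: "(nat \<Rightarrow> 'a) \<Rightarrow> (nat \<Rightarrow> 'a) measure" where
  "resample x = distr (\<kappa> (rest x)) \<pi> (\<lambda>y. x(j := y))"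

lemma resample_measurable: "resample \<in> \<pi> \<rightarrow>\<^sub>M prob_algebra \<pi>"
  unfolding resample_def[abs_def]
  by (rule measurable_distr_prob_space2[OF measurable_compose[OF rest_measurable \<kappa>_measurable]])
     (rule update_measurable)

text \<open>
  The conditional distribution is specified by its joint law with the remaining coordinates on
  product sets.  A box in the product space is such a set, and boxes determine a
  probability measure, so redrawing \<open>x\<^sub>j\<close> from its conditional distribution preserves \<open>\<pi>\<close>.
\<close>
lemma bind_resample: "\<pi> \<bind> resample = \<pi>"
proof (rule measure_eqI_PiM_finite[where I="{1..d}" and M=M, symmetric])
  note res = measurable_prob_algebraD[OF resample_measurable]
  show "sets \<pi> = sets (PiM {1..d} M)" by (rule sets_eq)
  show "sets (\<pi> \<bind> resample) = sets (PiM {1..d} M)"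
    using sets_bind[OF sets_kernel[OF res] not_empty] sets_eq by simp
  show "range (\<lambda>_. \<Pi>\<^sub>E i\<in>{1..d}. space (M i)) \<subseteq> prod_algebra {1..d} M"
    by (auto intro!: prod_algebraI_finite)
  show "(\<Union>i::nat. \<Pi>\<^sub>E i\<in>{1..d}. space (M i)) = space (PiM {1..d} M)"
    by (simp add: space_PiM)
  show "emeasure \<pi> (\<Pi>\<^sub>E i\<in>{1..d}. space (M i)) \<noteq> \<infinity>" by simp
  fix A assume A: "\<And>i. i \<in> {1..d} \<Longrightarrow> A i \<in> sets (M i)"
  let ?B = "PiE (others d j) A"
  have Aj: "A j \<in> sets (M j)" using A j by blast
  have B[measurable]: "?B \<in> sets (PiM (others d j) M)"
    using A by (intro sets_PiM_I_finite) (auto simp: others_def)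
  have PiE_sets: "PiE {1..d} A \<in> sets \<pi>"
    unfolding sets_eq using A by (intro sets_PiM_I_finite) auto
  have [measurable]: "(\<lambda>z. emeasure (\<kappa> z) (A j)) \<in> borel_measurable (PiM (others d j) M)"
    by (rule measurable_compose[OF measurable_prob_algebraD[OF \<kappa>_measurable]
          measurable_emeasure_subprob_algebra[OF Aj]])
  have "emeasure \<pi> (PiE {1..d} A) = emeasure \<pi> {x \<in> space \<pi>. x j \<in> A j \<and> rest x \<in> ?B}"
    using sets.sets_into_space[OF PiE_sets] PiE_insert_rest[of _ A]
    by (intro arg_cong[where f="emeasure \<pi>"] set_eqI) blast
  also have "\<dots> = (\<integral>\<^sup>+z\<in>?B. emeasure (\<kappa> z) (A j) \<partial>distr \<pi> (PiM (others d j) M) rest)"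
    using rcd Aj B unfolding regular_conditional_distribution_def by blast
  also have "\<dots> = (\<integral>\<^sup>+x. emeasure (\<kappa> (rest x)) (A j) * indicator ?B (rest x) \<partial>\<pi>)"
    by (subst nn_integral_distr) auto
  also have "\<dots> = (\<integral>\<^sup>+x. emeasure (resample x) (PiE {1..d} A) \<partial>\<pi>)"
  proof (rule nn_integral_cong)
    fix x assume x: "x \<in> space \<pi>"
    have m: "(\<lambda>y. x(j := y)) \<in> \<kappa> (rest x) \<rightarrow>\<^sub>M \<pi>"
      using update_measurable_right[OF x] measurable_cong_sets[OF sets_\<kappa>[OF x] refl] by blast
    have "(\<lambda>y. x(j := y)) -` PiE {1..d} A \<inter> space (\<kappa> (rest x)) = (if rest x \<in> ?B then A j else {})"
      using PiE_insert_rest[OF update_in_space[OF x]] sets.sets_into_space[OF Aj]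
        sets_eq_imp_space_eq[OF sets_\<kappa>[OF x]]
      by (auto simp: rest_update)
    then show "emeasure (\<kappa> (rest x)) (A j) * indicator ?B (rest x) =
        emeasure (resample x) (PiE {1..d} A)"
      unfolding resample_def emeasure_distr[OF m PiE_sets] by auto
  qed
  also have "\<dots> = emeasure (\<pi> \<bind> resample) (PiE {1..d} A)"
    by (rule emeasure_bind[OF not_empty res PiE_sets, symmetric])
  finally show "emeasure \<pi> (PiE {1..d} A) = emeasure (\<pi> \<bind> resample) (PiE {1..d} A)" .
qed simp

lemma nn_integral_disintegrate:
  assumes f: "f \<in> borel_measurable \<pi>"
  shows "(\<integral>\<^sup>+x. f x \<partial>\<pi>) = (\<integral>\<^sup>+x. \<integral>\<^sup>+y. f (x(j := y)) \<partial>\<kappa> (rest x) \<partial>\<pi>)"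
proof -
  have "(\<integral>\<^sup>+x. f x \<partial>\<pi>) = (\<integral>\<^sup>+x. f x \<partial>(\<pi> \<bind> resample))"
    by (simp add: bind_resample)
  also have "\<dots> = (\<integral>\<^sup>+x. \<integral>\<^sup>+y. f y \<partial>resample x \<partial>\<pi>)"
    by (rule nn_integral_bind[OF f measurable_prob_algebraD[OF resample_measurable]])
  also have "\<dots> = (\<integral>\<^sup>+x. \<integral>\<^sup>+y. f (x(j := y)) \<partial>\<kappa> (rest x) \<partial>\<pi>)"
  proof (rule nn_integral_cong)
    fix x assume x: "x \<in> space \<pi>"
    have "(\<lambda>y. x(j := y)) \<in> \<kappa> (rest x) \<rightarrow>\<^sub>M \<pi>"
      using update_measurable_right[OF x] measurable_cong_sets[OF sets_\<kappa>[OF x] refl] by blast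
    then show "(\<integral>\<^sup>+y. f y \<partial>resample x) = (\<integral>\<^sup>+y. f (x(j := y)) \<partial>\<kappa> (rest x))"
      unfolding resample_def using f by (simp add: nn_integral_distr)
  qed
  finally show ?thesis .
qed

context
  fixes k :: "(nat \<Rightarrow> 'a) \<Rightarrow> 'a \<Rightarrow> 'a measure"
  assumes cwk: "componentwise_kernel d M j \<kappa> k"
begin

lemma component_kernel: "x \<in> space \<pi> \<Longrightarrow> k (rest x) \<in> M j \<rightarrow>\<^sub>M prob_algebra (M j)"
  using cwk rest_in_space by (simp add: componentwise_kernel_def)

lemma component_kernel_at:
  assumes "x \<in> space \<pi>" "y \<in> space (M j)"
  shows "sets (k (rest x) y) = sets (M j)" "prob_space (k (rest x) y)"
  using measurable_space[OF component_kernel] assms by (auto simp: space_prob_algebra)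

definition lifted_kernel :: "(nat \<Rightarrow> 'a) \<Rightarrow> (nat \<Rightarrow> 'a) measure" where
  "lifted_kernel x = distr (k (rest x) (x j)) \<pi> (\<lambda>y. x(j := y))"

lemma update_measurable_kernel:
  assumes "x \<in> space \<pi>" "y \<in> space (M j)"
  shows "(\<lambda>y'. x(j := y')) \<in> k (rest x) y \<rightarrow>\<^sub>M \<pi>"
  using update_measurable_right[OF assms(1)]
    measurable_cong_sets[OF component_kernel_at(1)[OF assms] refl] by blast

lemma component_in_space: "x \<in> space \<pi> \<Longrightarrow> x j \<in> space (M j)"
  using measurable_space[OF component_measurable] .

lemma lifted_kernel_measurable: "lifted_kernel \<in> \<pi> \<rightarrow>\<^sub>M prob_algebra \<pi>"
  unfolding lifted_kernel_def[abs_def]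
proof (rule measurable_distr_prob_space2[OF _ update_measurable])
  show "(\<lambda>x. k (rest x) (x j)) \<in> \<pi> \<rightarrow>\<^sub>M prob_algebra (M j)"
  proof (intro measurable_prob_algebraI measurable_subprob_algebra)
    fix x assume x: "x \<in> space \<pi>"
    then show "prob_space (k (rest x) (x j))" "sets (k (rest x) (x j)) = sets (M j)"
      by (simp_all add: component_kernel_at component_in_space)
    then show "subprob_space (k (rest x) (x j))"
      by (simp add: prob_space_imp_subprob_space)
  next
    fix A assume "A \<in> sets (M j)"
    then have "(\<lambda>(x, z). emeasure (k z x) A) \<in> borel_measurable (M j \<Otimes>\<^sub>M PiM (others d j) M)"
      using cwk by (simp add: componentwise_kernel_def)
    from measurable_compose[OF measurable_Pair[OF component_measurable rest_measurable] this]
    show "(\<lambda>x. emeasure (k (rest x) (x j)) A) \<in> borel_measurable \<pi>" by simp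
  qed
qed

text \<open>
  Disintegrate \<open>\<pi>\<close> along coordinate \<open>j\<close>.  For fixed \<open>x\<^sub>-\<^sub>j\<close> the kernel only sees the sections of the two
  sets, which are sets in the \<open>j\<close>-th factor, and there reversibility is assumed.
\<close>
lemma reversible_lifted_kernel: "reversible_kernel \<pi> lifted_kernel"
proof -
  have *: "(\<integral>\<^sup>+x\<in>E. emeasure (lifted_kernel x) F \<partial>\<pi>) =
      (\<integral>\<^sup>+x. (\<integral>\<^sup>+y\<in>(\<lambda>y. x(j := y)) -` E \<inter> space (M j).
        emeasure (k (rest x) y) ((\<lambda>y. x(j := y)) -` F \<inter> space (M j)) \<partial>\<kappa> (rest x)) \<partial>\<pi>)"
    if E: "E \<in> sets \<pi>" and F: "F \<in> sets \<pi>" for E F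
  proof -
    have [measurable]: "(\<lambda>x. emeasure (lifted_kernel x) F) \<in> borel_measurable \<pi>"
      by (rule measurable_compose[OF measurable_prob_algebraD[OF lifted_kernel_measurable]
          measurable_emeasure_subprob_algebra[OF F]])
    note [measurable] = E
    show ?thesis
    proof (subst nn_integral_disintegrate, simp, intro nn_integral_cong)
      fix x y assume x: "x \<in> space \<pi>" and "y \<in> space (\<kappa> (rest x))"
      then have y: "y \<in> space (M j)"
        using sets_eq_imp_space_eq[OF sets_\<kappa>[OF x]] by simp
      have upd: "(\<lambda>y'. (x(j := y))(j := y')) = (\<lambda>y'. x(j := y'))"
        by simp
      have "emeasure (lifted_kernel (x(j := y))) F =
          emeasure (k (rest x) y) ((\<lambda>y. x(j := y)) -` F \<inter> space (M j))"
        unfolding lifted_kernel_def rest_update upd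
        using emeasure_distr[OF update_measurable_kernel[OF x y] F]
          sets_eq_imp_space_eq[OF component_kernel_at(1)[OF x y]] by simp
      then show "emeasure (lifted_kernel (x(j := y))) F * indicator E (x(j := y)) =
          emeasure (k (rest x) y) ((\<lambda>y. x(j := y)) -` F \<inter> space (M j)) *
            indicator ((\<lambda>y. x(j := y)) -` E \<inter> space (M j)) y"
        using y by (simp add: indicator_def)
    qed
  qed
  show ?thesis
    unfolding reversible_kernel_def
  proof (intro ballI)
    fix E F assume EF: "E \<in> sets \<pi>" "F \<in> sets \<pi>"
    show "(\<integral>\<^sup>+x\<in>E. emeasure (lifted_kernel x) F \<partial>\<pi>) = (\<integral>\<^sup>+x\<in>F. emeasure (lifted_kernel x) E \<partial>\<pi>)"
      unfolding *[OF EF] *[OF EF(2,1)]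
    proof (rule nn_integral_cong)
      fix x assume x: "x \<in> space \<pi>"
      have "reversible_kernel (\<kappa> (rest x)) (k (rest x))"
        using cwk rest_in_space[OF x] by (simp add: componentwise_kernel_def)
      moreover have "(\<lambda>y. x(j := y)) -` A \<inter> space (M j) \<in> sets (\<kappa> (rest x))" if "A \<in> sets \<pi>" for A
        using measurable_sets[OF update_measurable_right[OF x] that] sets_\<kappa>[OF x] by simp
      ultimately show "(\<integral>\<^sup>+y\<in>(\<lambda>y. x(j := y)) -` E \<inter> space (M j).
          emeasure (k (rest x) y) ((\<lambda>y. x(j := y)) -` F \<inter> space (M j)) \<partial>\<kappa> (rest x)) =
        (\<integral>\<^sup>+y\<in>(\<lambda>y. x(j := y)) -` F \<inter> space (M j).
          emeasure (k (rest x) y) ((\<lambda>y. x(j := y)) -` E \<inter> space (M j)) \<partial>\<kappa> (rest x))"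
        using EF by (simp add: reversible_kernel_def)
    qed
  qed
qed

lemma L2_markov_operator_component:
  "L2_markov_operator \<pi> (\<lambda>f x. \<integral>y. f (x(j := y)) \<partial>k (rest x) (x j))"
proof -
  interpret reversible_markov_kernel \<pi> lifted_kernel
    by unfold_locales (fact lifted_kernel_measurable reversible_lifted_kernel)+
  show ?thesis
  proof (rule L2_markov_operator_eqI[OF L2_markov_operator_avg])
    fix f x assume "f \<in> L2 \<pi>" and x: "x \<in> space \<pi>"
    then have "f \<in> borel_measurable \<pi>" by (simp add: L2_measurable)
    then show "(\<integral>y. f (x(j := y)) \<partial>k (rest x) (x j)) = avg f x"
      unfolding avg_def lifted_kernel_def
      using update_measurable_kernel[OF x component_in_space[OF x]]
      by (simp add: integral_distr)
  qed
qed

end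

end

lemma
  assumes cc: "conditional_component \<pi> d M j (\<kappa> j)"
  shows L2_markov_operator_cw_update:
      "componentwise_kernel d M j (\<kappa> j) (K j) \<Longrightarrow> L2_markov_operator \<pi> (cw_update d K j)"
    and L2_markov_operator_gibbs_update: "L2_markov_operator \<pi> (gibbs_update d \<kappa> j)"
proof -
  interpret conditional_component \<pi> d M j "\<kappa> j" by fact
  have *: "L2_markov_operator \<pi> (cw_update d K j)" if "componentwise_kernel d M j (\<kappa> j) (K j)" for K
    using L2_markov_operator_component[OF that] by (simp add: cw_update_def[abs_def])
  show "componentwise_kernel d M j (\<kappa> j) (K j) \<Longrightarrow> L2_markov_operator \<pi> (cw_update d K j)"
    by (rule *)
  show "L2_markov_operator \<pi> (gibbs_update d \<kappa> j)"
    unfolding gibbs_update_eq_cw_update by (rule *) (rule componentwise_kernel_gibbs[OF rcd])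
qed

text \<open>A Gibbs average does not depend on \<open>x\<^sub>j\<close>, so averaging it over \<open>x\<^sub>j\<close> again changes nothing.\<close>
lemma cw_update_gibbs_update:
  assumes cc: "conditional_component \<pi> d M j (\<kappa> j)"
    and cwk: "componentwise_kernel d M j (\<kappa> j) (K j)" and x: "x \<in> space \<pi>"
  shows "cw_update d K j (gibbs_update d \<kappa> j f) x = gibbs_update d \<kappa> j f x"
proof -
  interpret conditional_component \<pi> d M j "\<kappa> j" by fact
  interpret k: prob_space "K j (rest x) (x j)"
    using cwk x by (intro component_kernel_at component_in_space)
  have "gibbs_update d \<kappa> j f (x(j := y)) = gibbs_update d \<kappa> j f x" for y
    by (simp add: gibbs_update_def rest_update)
  then show ?thesis
    by (simp add: cw_update_def k.prob_space)
qed

lemma gibbs_update_idem: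
  assumes cc: "conditional_component \<pi> d M j (\<kappa> j)" and x: "x \<in> space \<pi>"
  shows "gibbs_update d \<kappa> j (gibbs_update d \<kappa> j f) x = gibbs_update d \<kappa> j f x"
proof -
  interpret conditional_component \<pi> d M j "\<kappa> j" by fact
  show ?thesis
    using cw_update_gibbs_update[where K="\<lambda>j z _. \<kappa> j z" and \<kappa>=\<kappa> and j=j,
        OF cc componentwise_kernel_gibbs[OF rcd] x]
    by (simp add: gibbs_update_eq_cw_update)
qed

section \<open>Comparison of the scans\<close>

text \<open>
  The operator norm is an infimum of admissible bounds; that it is itself one follows by letting
  the excess \<open>e\<close> tend to \<open>0\<close>.
\<close>
lemma L2_opnorm_leD:
  assumes le: "L2_opnorm \<pi> T \<le> ereal c" and f: "f \<in> L2 \<pi>"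
  shows "T f \<in> L2 \<pi>" "L2_norm \<pi> (T f) \<le> c * L2_norm \<pi> f"
proof -
  have ex: "\<exists>b < c + e. \<forall>f\<in>L2 \<pi>. T f \<in> L2 \<pi> \<and> L2_norm \<pi> (T f) \<le> b * L2_norm \<pi> f"
    if "e > 0" for e
  proof -
    have "L2_opnorm \<pi> T < ereal (c + e)"
      using le that by (auto intro: le_less_trans)
    then show ?thesis
      unfolding L2_opnorm_def Inf_less_iff by auto
  qed
  then show "T f \<in> L2 \<pi>" using f zero_less_one by blast
  show "L2_norm \<pi> (T f) \<le> c * L2_norm \<pi> f"
  proof (rule field_le_epsilon)
    fix e :: real assume e: "0 < e"
    let ?n = "L2_norm \<pi> f"
    have n: "0 \<le> ?n" by (rule L2_norm_nonneg)
    obtain b where "b < c + e / (?n + 1)" "L2_norm \<pi> (T f) \<le> b * ?n"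
      using ex[of "e / (?n + 1)"] e n f by auto
    then have "L2_norm \<pi> (T f) \<le> (c + e / (?n + 1)) * ?n"
      using n by (meson less_imp_le mult_right_mono order_trans)
    also have "e / (?n + 1) * ?n \<le> e"
      using e n by (simp add: field_simps)
    then have "(c + e / (?n + 1)) * ?n \<le> c * ?n + e"
      by (simp add: distrib_right)
    finally show "L2_norm \<pi> (T f) \<le> c * ?n + e" .
  qed
qed

lemma L2_opnorm_leI:
  assumes "0 \<le> c" "\<And>f. f \<in> L2 \<pi> \<Longrightarrow> T f \<in> L2 \<pi>"
    and "\<And>f. f \<in> L2 \<pi> \<Longrightarrow> L2_norm \<pi> (T f) \<le> c * L2_norm \<pi> f"
  shows "L2_opnorm \<pi> T \<le> ereal c"
  unfolding L2_opnorm_def using assms by (intro Inf_lower) auto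

lemma relaxed_projection_cw_update:
  assumes cc: "conditional_component \<pi> d M j (\<kappa> j)"
    and cwk: "componentwise_kernel d M j (\<kappa> j) (K j)"
    and r: "0 \<le> r" "r < 1"
    and near: "L2_opnorm \<pi> (op_diff (cw_update d K j) (gibbs_update d \<kappa> j)) \<le> ereal r"
  shows "relaxed_projection \<pi> (cw_update d K j) (gibbs_update d \<kappa> j) r"
proof -
  interpret T: L2_markov_operator \<pi> "cw_update d K j"
    using cc cwk by (rule L2_markov_operator_cw_update)
  interpret P: L2_markov_operator \<pi> "gibbs_update d \<kappa> j"
    using cc by (rule L2_markov_operator_gibbs_update)
  show ?thesis
  proof
    fix f assume "f \<in> L2 \<pi>"
    then show "L2_norm \<pi> (\<lambda>x. cw_update d K j f x - gibbs_update d \<kappa> j f x) \<le> r * L2_norm \<pi> f"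
      using L2_opnorm_leD(2)[OF near] by (simp add: op_diff_def[abs_def])
  qed (use r cw_update_gibbs_update[where K=K and \<kappa>=\<kappa> and j=j, OF cc cwk]
      gibbs_update_idem[where \<kappa>=\<kappa> and j=j, OF cc] in auto)
qed

lemma (in prob_space) L2_centred_norm_le:
  assumes f: "f \<in> L2 M"
  shows "L2_norm M (\<lambda>x. f x - expectation f) \<le> L2_norm M f"
proof (rule power2_le_imp_le)
  let ?m = "expectation f"
  have "(L2_norm M (\<lambda>x. f x - ?m))\<^sup>2 = (\<integral>x. f x * f x - 2 * ?m * f x + ?m * ?m \<partial>M)"
    unfolding L2_norm_square L2_inner_def
    by (intro Bochner_Integration.integral_cong) (simp_all add: algebra_simps)
  also have "\<dots> = (\<integral>x. f x * f x \<partial>M) - ?m * ?m"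
    using f L2_integrable[OF f] by (simp add: L2_def prob_space)
  also have "\<dots> \<le> (L2_norm M f)\<^sup>2"
    by (simp add: L2_norm_square L2_inner_def)
  finally show "(L2_norm M (\<lambda>x. f x - ?m))\<^sup>2 \<le> (L2_norm M f)\<^sup>2" .
qed (rule L2_norm_nonneg)

text \<open>
  Markov operators fix constants, so a sweep commutes with centring.  This has to be carried
  through the sweep as an almost sure equality of representatives.
\<close>
lemma fold_L2_markov_operator:
  assumes "\<And>j. j \<in> set js \<Longrightarrow> L2_markov_operator \<pi> (T j)"
    and "f \<in> L2 \<pi>" "g \<in> L2 \<pi>" "AE x in \<pi>. f x = g x + c"
  shows "fold T js f \<in> L2 \<pi> \<and> (AE x in \<pi>. fold T js f x = fold T js g x + c)"
  using assms
proof (induction js arbitrary: f g)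
  case (Cons j js)
  interpret L2_markov_operator \<pi> "T j" using Cons.prems by simp
  have *: "T j f \<in> L2 \<pi>" "T j g \<in> L2 \<pi>" "AE x in \<pi>. T j f x = T j g x + c"
    using Cons.prems in_L2 shift by auto
  show ?case using Cons.IH[OF _ *] Cons.prems(1) by simp
qed auto

text \<open>
  On centred functions the random scan has norm at most \<open>1 - \<eta>\<close>, so \<open>\<langle>f, f - P\<^sub>R\<^sub>C\<^sub>W f\<rangle> \<ge> \<eta> \<parallel>f\<parallel>\<^sup>2\<close> by the
  Cauchy-Schwarz inequality, and the left-hand side is the average of the Dirichlet forms of the \<open>K\<^sub>j\<close>.
\<close>
lemma rcw_dirichlet_gap:
  assumes d: "d \<ge> 1"
    and K: "\<And>j. j \<in> {1..d} \<Longrightarrow> L2_markov_operator \<pi> (cw_update d K j)"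
    and gap: "L2_opnorm \<pi> (op_diff (rcw d K) (mean_op \<pi>)) \<le> ereal (1 - \<eta>)"
    and f: "f \<in> L2 \<pi>" and mean: "(\<integral>x. f x \<partial>\<pi>) = 0"
  shows "real d * \<eta> * (L2_norm \<pi> f)\<^sup>2 \<le> (\<Sum>j\<in>{1..d}. L2_inner \<pi> f (\<lambda>x. f x - cw_update d K j f x))"
proof -
  have T: "cw_update d K j f \<in> L2 \<pi>" if "j \<in> {1..d}" for j
    using L2_markov_operator.in_L2[OF K[OF that] f] .
  have "op_diff (rcw d K) (mean_op \<pi>) f = rcw d K f"
    by (simp add: fun_eq_iff op_diff_def mean_op_def mean)
  then have R: "rcw d K f \<in> L2 \<pi>" "L2_norm \<pi> (rcw d K f) \<le> (1 - \<eta>) * L2_norm \<pi> f"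
    using L2_opnorm_leD[OF gap f] by simp_all
  have "L2_inner \<pi> f (rcw d K f) =
      (\<integral>x. (1 / real d) * (\<Sum>j\<in>{1..d}. f x * cw_update d K j f x) \<partial>\<pi>)"
    by (simp add: L2_inner_def rcw_def sum_distrib_left)
  also have "\<dots> = (1 / real d) * (\<Sum>j\<in>{1..d}. L2_inner \<pi> f (cw_update d K j f))"
    using L2_mult_integrable[OF f T]
    by (simp add: L2_inner_def Bochner_Integration.integral_sum)
  finally have "(\<Sum>j\<in>{1..d}. L2_inner \<pi> f (cw_update d K j f)) = real d * L2_inner \<pi> f (rcw d K f)"
    using d by simp
  also have "\<dots> \<le> real d * (L2_norm \<pi> f * ((1 - \<eta>) * L2_norm \<pi> f))"
    using abs_le_D1[OF L2_Cauchy_Schwarz[OF f R(1)]] mult_left_mono[OF R(2) L2_norm_nonneg[of \<pi> f]]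
    by (intro mult_left_mono) auto
  finally show ?thesis
    using f T by (simp add: L2_inner_diff_right sum_subtractf L2_norm_square[symmetric]
        power2_eq_square algebra_simps)
qed

theorem theorem1p1:
  fixes d :: nat
    and M :: "nat \<Rightarrow> 'a measure"
    and \<pi> :: "(nat \<Rightarrow> 'a) measure"
    and \<kappa> :: "nat \<Rightarrow> (nat \<Rightarrow> 'a) \<Rightarrow> 'a measure"
    and K :: "nat \<Rightarrow> (nat \<Rightarrow> 'a) \<Rightarrow> 'a \<Rightarrow> 'a measure"
    and lambda0 \<eta> :: real
  assumes "d \<ge> 1"
    and "\<And>j. j \<in> {1..d} \<Longrightarrow> polish_measurable_space (M j)"
    and "prob_space \<pi>" and "sets \<pi> = sets (PiM {1..d} M)"
    and "\<And>j. j \<in> {1..d} \<Longrightarrow> regular_conditional_distribution d M \<pi> j (\<kappa> j)"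
    and "\<And>j. j \<in> {1..d} \<Longrightarrow> componentwise_kernel d M j (\<kappa> j) (K j)"
    and "0 < lambda0" and "lambda0 < 1"
    and "\<And>j. j \<in> {1..d} \<Longrightarrow>
           L2_opnorm \<pi> (op_diff (cw_update d K j) (gibbs_update d \<kappa> j)) \<le> ereal lambda0"
    and "0 < \<eta>" and "\<eta> \<le> 1"
    and "L2_opnorm \<pi> (op_diff (rcw d K) (mean_op \<pi>)) \<le> ereal (1 - \<eta>)"
  shows "L2_opnorm \<pi> (op_diff (dcw d K) (mean_op \<pi>)) \<le>
           ereal (1 - (1 - lambda0)\<^sup>2 / (8 * (real d + 1) * (1 + lambda0)) * \<eta>)"
proof -
  interpret prob_space \<pi> by fact
  have cc: "conditional_component \<pi> d M j (\<kappa> j)" if "j \<in> {1..d}" for j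
    using assms(4,5) that by unfold_locales auto
  have K: "L2_markov_operator \<pi> (cw_update d K j)" if "j \<in> {1..d}" for j
    using cc assms(6) that by (intro L2_markov_operator_cw_update)
  have rp: "relaxed_projection \<pi> (cw_update d K j) (gibbs_update d \<kappa> j) lambda0" if "j \<in> {1..d}" for j
    using cc assms(6,7,8,9) that by (intro relaxed_projection_cw_update) auto
  let ?c = "1 - (1 - lambda0)\<^sup>2 / (8 * (real d + 1) * (1 + lambda0)) * \<eta>"
  have c: "0 \<le> ?c"
    using assms by (intro sweep_rate_nonneg) auto
  have main: "op_diff (dcw d K) (mean_op \<pi>) f \<in> L2 \<pi> \<and>
      L2_norm \<pi> (op_diff (dcw d K) (mean_op \<pi>) f) \<le> ?c * L2_norm \<pi> f" if f: "f \<in> L2 \<pi>" for f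
  proof -
    (* The mean operator vanishes on the centred function h, which is where the gap of the
       random scan can be used, and centring does not increase the norm. *)
    define h where "h = (\<lambda>x. f x - expectation f)"
    have h: "h \<in> L2 \<pi>" unfolding h_def by (intro L2_diff f L2_const)
    have "expectation h = 0"
      unfolding h_def using L2_integrable[OF f] by (simp add: prob_space)
    then have gap: "real d * \<eta> * (L2_norm \<pi> h)\<^sup>2 \<le>
        (\<Sum>j\<in>{1..d}. L2_inner \<pi> h (\<lambda>x. h x - cw_update d K j h x))"
      using assms K h by (intro rcw_dirichlet_gap) auto
    have K': "L2_markov_operator \<pi> (cw_update d K j)" if "j \<in> set [1..<Suc d]" for j
      using K that by auto
    have fh: "AE x in \<pi>. f x = h x + expectation f" "AE x in \<pi>. h x = h x + 0"
      by (simp_all add: h_def)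
    have dcw: "dcw d K f \<in> L2 \<pi>" "dcw d K h \<in> L2 \<pi>"
      "AE x in \<pi>. dcw d K f x = dcw d K h x + expectation f"
      unfolding dcw_def
      using fold_L2_markov_operator[where T="cw_update d K" and js="[1..<Suc d]", OF K' f h fh(1)]
        fold_L2_markov_operator[where T="cw_update d K" and js="[1..<Suc d]", OF K' h h fh(2)]
      by blast+
    have D: "op_diff (dcw d K) (mean_op \<pi>) f = (\<lambda>x. dcw d K f x - expectation f)"
      by (simp add: fun_eq_iff op_diff_def mean_op_def)
    have DL2: "op_diff (dcw d K) (mean_op \<pi>) f \<in> L2 \<pi>"
      unfolding D by (intro L2_diff dcw L2_const)
    have "L2_norm \<pi> (op_diff (dcw d K) (mean_op \<pi>) f) = L2_norm \<pi> (dcw d K h)"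
      using DL2 dcw by (intro L2_norm_cong_AE) (auto simp: D)
    also have "\<dots> \<le> ?c * L2_norm \<pi> h"
      unfolding dcw_def using assms rp h gap
      by (intro sweep_contraction[where P="gibbs_update d \<kappa>"]) auto
    also have "\<dots> \<le> ?c * L2_norm \<pi> f"
      unfolding h_def by (intro mult_left_mono L2_centred_norm_le f c)
    finally show ?thesis using DL2 by blast
  qed
  show ?thesis
    using main by (intro L2_opnorm_leI c) auto
qed

end
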